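(* Let $\Phi$ be a root system of type $D_n$ ($n\ge 4$), $E_6$, $E_7$ or $E_8$, with simple roots $\Pi$ and positive roots $\Phi^+$, and for $t\ge1$ let $\mathcal{I}_t=\{\alpha\in\Phi^+:\mathrm{ht}(\alpha)\ge t\}$. Let $\mathcal{I}$ be an ideal of $\Phi^+$. Then: (i) if $\mathcal{I}\supseteq\mathcal{I}_3$, then $\mathcal{A}_\mathcal{I}$ is supersolvable; (ii) if $\mathcal{I}\supseteq\mathcal{I}_4$, then $\mathcal{A}_\mathcal{I}$ is inductively factored.
   Context: Heights $\mathrm{ht}(\sum_{\alpha\in\Pi}c_\alpha\alpha)=\sum c_\alpha$. An ideal of $\Phi^+$ is $\mathcal{I}\subseteq\Phi^+$ with $\alpha\in\mathcal{I},\beta\in\Phi^+,\alpha+\beta\in\Phi^+\Rightarrow\alpha+\beta\in\mathcal{I}$; $\mathcal{I}^c=\Phi^+\setminus\mathcal{I}$; $H_\alpha$ the hyperplane orthogonal to $\alpha$ in $V=\mathbb{R}\otimes\mathbb{Z}\Phi$; $\mathcal{A}_\mathcal{I}=\{H_\alpha:\alpha\in\mathcal{I}^c\}$. For a central arrangement $\mathcal{A}$: $L(\mathcal{A})$ = intersections of subsets of $\mathcal{A}$, ordered by reverse inclusion, rank = codimension; $X\in L(\mathcal{A})$ is modular if $X+Y\in L(\mathcal{A})$ for all $Y\in L(\mathcal{A})$; $\mathcal{A}$ is supersolvable if there is a maximal chain $V=X_0<\cdots<X_r=\bigcap_{H\in\mathcal{A}}H$ of modular elements. Inductively factored: the class of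 pairs $(\mathcal{A},\pi)$, $\pi=(\pi_1,\ldots,\pi_s)$ an ordered partition of $\mathcal{A}$, is the smallest class containing $(\varnothing,())$ in every dimension and containing $(\mathcal{A},\pi)$ whenever some $H_0\in\pi_1$ makes $\mathcal{A}\setminus\pi_1\to\mathcal{A}''$, $H\mapsto H\cap H_0$, bijective (where $\mathcal{A}'=\mathcal{A}\setminus\{H_0\}$, $\mathcal{A}''=\{H_0\cap H:H\in\mathcal{A}'\}$) and $(\mathcal{A}',\pi')$, $(\mathcal{A}'',\pi'')$ are in the class, with $\pi'$ the nonempty $\pi_i\cap\mathcal{A}'$ and $\pi''=(\{H\cap H_0:H\in\pi_i\})_{i=2}^s$; $\mathcal{A}$ is inductively factored if some such $\pi$ exists.
   Formalization: In "inductively factored" the blocks of the ordered partition may be renumbered at each stage, so π_1 can be chosen afresh; with the order kept fixed, (ii) fails for D_4 and I = I_4. *)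

theory Defs
  imports "HOL-Analysis.Analysis"
begin

section \<open>Root systems\<close>

definition cartan_int :: "'a::euclidean_space \<Rightarrow> 'a \<Rightarrow> real" where
  "cartan_int \<alpha> \<beta> = 2 * (\<alpha> \<bullet> \<beta>) / (\<beta> \<bullet> \<beta>)"

text \<open>Reduced crystallographic root systems. The roots are not required to span the ambient
  type: the space \<open>V\<close> of the root system is \<open>span \<Phi>\<close>.\<close>

definition root_system :: "'a::euclidean_space set \<Rightarrow> bool" where
  "root_system \<Phi> \<longleftrightarrow>
     finite \<Phi> \<and> 0 \<notin> \<Phi> \<and>
     (\<forall>\<alpha>\<in>\<Phi>. \<forall>\<beta>\<in>\<Phi>. \<alpha> - cartan_int \<alpha> \<beta> *\<^sub>R \<beta> \<in> \<Phi>) \<and>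
     (\<forall>\<alpha>\<in>\<Phi>. \<forall>\<beta>\<in>\<Phi>. cartan_int \<alpha> \<beta> \<in> \<int>) \<and>
     (\<forall>\<alpha>\<in>\<Phi>. \<forall>c. c *\<^sub>R \<alpha> \<in> \<Phi> \<longrightarrow> c = 1 \<or> c = - 1)"

text \<open>\<open>representation \<Delta> \<alpha> \<beta>\<close> is the coefficient of \<open>\<beta>\<close> in the expansion of \<open>\<alpha>\<close> in the
  linearly independent set \<open>\<Delta>\<close> of simple roots.\<close>

definition simple_roots :: "'a::euclidean_space set \<Rightarrow> 'a set \<Rightarrow> bool" where
  "simple_roots \<Phi> \<Delta> \<longleftrightarrow>
     \<Delta> \<subseteq> \<Phi> \<and> independent \<Delta> \<and>
     (\<forall>\<alpha>\<in>\<Phi>. \<alpha> \<in> span \<Delta> \<and> (\<forall>\<beta>\<in>\<Delta>. representation \<Delta> \<alpha> \<beta> \<in> \<int>) \<and>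
        ((\<forall>\<beta>\<in>\<Delta>. 0 \<le> representation \<Delta> \<alpha> \<beta>) \<or> (\<forall>\<beta>\<in>\<Delta>. representation \<Delta> \<alpha> \<beta> \<le> 0)))"

definition positive_roots :: "'a::euclidean_space set \<Rightarrow> 'a set \<Rightarrow> 'a set" where
  "positive_roots \<Phi> \<Delta> = {\<alpha>\<in>\<Phi>. \<forall>\<beta>\<in>\<Delta>. 0 \<le> representation \<Delta> \<alpha> \<beta>}"

definition ht :: "'a::euclidean_space set \<Rightarrow> 'a \<Rightarrow> real" where
  "ht \<Delta> \<alpha> = (\<Sum>\<beta>\<in>\<Delta>. representation \<Delta> \<alpha> \<beta>)"

text \<open>Simply laced Dynkin diagrams: the graph on \<open>{1..n}\<close> with edge set \<open>E\<close> (edges are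
  two-element sets) is the Dynkin diagram of \<open>\<Delta>\<close>.\<close>

definition has_dynkin_diagram :: "'a::euclidean_space set \<Rightarrow> nat \<Rightarrow> nat set set \<Rightarrow> bool" where
  "has_dynkin_diagram \<Delta> n E \<longleftrightarrow>
     (\<exists>a. bij_betw a {1..n} \<Delta> \<and>
       (\<forall>i\<in>{1..n}. \<forall>j\<in>{1..n}. i \<noteq> j \<longrightarrow>
          cartan_int (a i) (a j) = (if {i, j} \<in> E then - 1 else 0)))"

text \<open>Vertices are numbered as in Bourbaki.\<close>

definition type_D :: "nat \<Rightarrow> 'a::euclidean_space set \<Rightarrow> bool" where
  "type_D n \<Delta> \<longleftrightarrow>
     has_dynkin_diagram \<Delta> n (insert {n - 2, n} {{i, i + 1} | i. 1 \<le> i \<and> i \<le> n - 2})"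

definition type_E :: "nat \<Rightarrow> 'a::euclidean_space set \<Rightarrow> bool" where
  "type_E n \<Delta> \<longleftrightarrow>
     has_dynkin_diagram \<Delta> n ({{1, 3}, {2, 4}} \<union> {{i, i + 1} | i. 3 \<le> i \<and> i < n})"

definition root_ideal :: "'a::euclidean_space set \<Rightarrow> 'a set \<Rightarrow> 'a set \<Rightarrow> bool" where
  "root_ideal \<Phi> \<Delta> I \<longleftrightarrow>
     I \<subseteq> positive_roots \<Phi> \<Delta> \<and>
     (\<forall>\<alpha>\<in>I. \<forall>\<beta>\<in>positive_roots \<Phi> \<Delta>.
        \<alpha> + \<beta> \<in> positive_roots \<Phi> \<Delta> \<longrightarrow> \<alpha> + \<beta> \<in> I)"

definition height_ideal :: "'a::euclidean_space set \<Rightarrow> 'a set \<Rightarrow> nat \<Rightarrow> 'a set" where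
  "height_ideal \<Phi> \<Delta> t = {\<alpha> \<in> positive_roots \<Phi> \<Delta>. real t \<le> ht \<Delta> \<alpha>}"

definition root_hyperplane :: "'a::euclidean_space set \<Rightarrow> 'a \<Rightarrow> 'a set" where
  "root_hyperplane \<Phi> \<alpha> = {v \<in> span \<Phi>. \<alpha> \<bullet> v = 0}"

definition ideal_arrangement :: "'a::euclidean_space set \<Rightarrow> 'a set \<Rightarrow> 'a set \<Rightarrow> 'a set set" where
  "ideal_arrangement \<Phi> \<Delta> I = root_hyperplane \<Phi> ` (positive_roots \<Phi> \<Delta> - I)"


section \<open>Central arrangements\<close>

text \<open>The ambient space of an arrangement is an explicit subspace \<open>V\<close>, so that the
  restriction of an arrangement to one of its hyperplanes is again an arrangement.\<close>

definition central_arrangement :: "'a::euclidean_space set \<Rightarrow> 'a set set \<Rightarrow> bool" where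
  "central_arrangement V A \<longleftrightarrow>
     subspace V \<and> finite A \<and> (\<forall>H\<in>A. subspace H \<and> H \<subseteq> V \<and> dim H + 1 = dim V)"

text \<open>The intersection over the empty subset of \<open>A\<close> is \<open>V\<close>.\<close>

definition intersection_lattice :: "'a::euclidean_space set \<Rightarrow> 'a set set \<Rightarrow> 'a set set" where
  "intersection_lattice V A = {V \<inter> \<Inter>B | B. B \<subseteq> A}"

text \<open>\<open>X + Y\<close> is the elementwise sum of sets.\<close>

definition modular_element :: "'a::euclidean_space set \<Rightarrow> 'a set set \<Rightarrow> 'a set \<Rightarrow> bool" where
  "modular_element V A X \<longleftrightarrow>
     X \<in> intersection_lattice V A \<and>
     (\<forall>Y \<in> intersection_lattice V A. X + Y \<in> intersection_lattice V A)"

text \<open>The order on the lattice is reverse inclusion, so the chain descends as sets; it is maximal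
  when no lattice element lies strictly between consecutive members.\<close>

definition supersolvable :: "'a::euclidean_space set \<Rightarrow> 'a set set \<Rightarrow> bool" where
  "supersolvable V A \<longleftrightarrow>
     (\<exists>(X :: nat \<Rightarrow> 'a set) r. X 0 = V \<and> X r = V \<inter> \<Inter>A \<and>
        (\<forall>i\<le>r. modular_element V A (X i)) \<and>
        (\<forall>i<r. X (Suc i) \<subset> X i \<and>
           \<not> (\<exists>Y \<in> intersection_lattice V A. X (Suc i) \<subset> Y \<and> Y \<subset> X i)))"

definition ordered_partition :: "'a set set \<Rightarrow> 'a set set list \<Rightarrow> bool" where
  "ordered_partition A \<pi> \<longleftrightarrow> distinct \<pi> \<and> partition_on A (set \<pi>)"

text \<open>In rule \<open>step\<close> the first block is the distinguished one. Rule \<open>renumber\<close> makes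
  explicit the convention that the numbering of the blocks is immaterial: it only serves to name
  the distinguished block \<open>\<pi>\<^sub>1\<close>, which may be chosen afresh at each stage of the induction. If
  the numbering were instead kept throughout, all hyperplanes of \<open>\<pi>\<^sub>1\<close> would have to be
  removed before any other, and, for instance, the arrangement of the roots of height at most 3 in
  type \<open>D\<^sub>4\<close> (exponents 1, 3, 3, 3) would not be inductively factored.\<close>

inductive inductively_factored_pair ::
    "'a::euclidean_space set \<Rightarrow> 'a set set \<Rightarrow> 'a set set list \<Rightarrow> bool" where
  empty: "subspace V \<Longrightarrow> inductively_factored_pair V {} []"
| step: "\<lbrakk> central_arrangement V A;
           ordered_partition A (P # Ps);
           H\<^sub>0 \<in> P;
           A' = A - {H\<^sub>0};
           A'' = (\<lambda>H. H \<inter> H\<^sub>0) ` A';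
           bij_betw (\<lambda>H. H \<inter> H\<^sub>0) (A - P) A'';
           inductively_factored_pair V A' (filter (\<lambda>B. B \<noteq> {}) (map (\<lambda>B. B \<inter> A') (P # Ps)));
           inductively_factored_pair H\<^sub>0 A'' (map (\<lambda>B. (\<lambda>H. H \<inter> H\<^sub>0) ` B) Ps) \<rbrakk>
         \<Longrightarrow> inductively_factored_pair V A (P # Ps)"
| renumber: "\<lbrakk> inductively_factored_pair V A \<pi>; mset \<pi>' = mset \<pi> \<rbrakk>
         \<Longrightarrow> inductively_factored_pair V A \<pi>'"

definition inductively_factored :: "'a::euclidean_space set \<Rightarrow> 'a set set \<Rightarrow> bool" where
  "inductively_factored V A \<longleftrightarrow> (\<exists>\<pi>. inductively_factored_pair V A \<pi>)"

end

(* Say that a set P of hyperplanes is a modular block over A when no member of P contains the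
   centre of A and any two members H, H' of P satisfy H \<inter> H' = K \<inter> H' for some K in A. Adding a
   modular block preserves supersolvability (the centre of the smaller arrangement becomes a modular
   coatom) and inductive factoredness (restricting to a member of P leaves A combinatorially
   unchanged).

   A root of height at most 3 is the sum of the vertices of a path of the Dynkin diagram. Number the
   diagram outwards from its branch vertex 0, with neighbours 1, 2, 3, and let k' be the neighbour of
   k towards 0. For heights at most 2 the blocks {k, k + k'} are modular. For heights at most 3 so are
   the blocks {k, k + k', k + k' + k''} for k >= 4, which reduces the claim to the subdiagram D4 on
   0, 1, 2, 3. If one of its three roots of height 3 is missing, modular blocks suffice again;
   otherwise two hyperplanes have to be removed first. *)

theory Submission
  imports Defs
begin

section \<open>Hyperplanes and modular blocks\<close>

text \<open>Two functionals \<open>a\<close> and \<open>b\<close> vanish together inside the kernel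
  of \<open>a - b\<close>. So a block of roots is modular once its differences are, up to sign,
  roots already present; they are summands of roots of the block, and the complement of an ideal
  keeps such summands. For a vertex k >= 4 the roots of height at most 3 with largest vertex k form
  a chain, whose differences are roots.

  The obstacle sits at the branch vertex c with neighbours x, y, z: the roots c + z + x and c + y +
  z share the largest vertex z, but their difference x - y is no root. On the kernel of c + y + z
  one has y = -c - z, and the other nine roots of the subdiagram become, up to sign, c, z, c + z, x,
  c + x, x - z, c + z + x. Now c + z + x does not fit into the block of x, since its difference from
  x - z is c + 2z. On its kernel z = -c - x, and c, x, c + x, c + 2x remain, the positive roots of
  type B2. These are the two hyperplanes that need separate treatment.\<close>

definition hyperplane_of :: "'a::euclidean_space set \<Rightarrow> 'a set \<Rightarrow> bool" where
  "hyperplane_of V H \<longleftrightarrow> subspace V \<and> subspace H \<and> H \<subseteq> V \<and> dim H + 1 = dim V"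

text \<open>A functional is kept as a vector of the ambient type, so restricting to a hyperplane
  shrinks \<open>V\<close> and leaves \<open>a\<close> as it is.\<close>

definition hyp :: "'a::euclidean_space set \<Rightarrow> 'a \<Rightarrow> 'a set" where
  "hyp V a = {v \<in> V. a \<bullet> v = 0}"

text \<open>One direction \<open>w\<close> along which every vector of \<open>V\<close> reaches
  \<open>H\<close> spares the later lemmas their dimension counts; the next lemma is the
  converse.\<close>

lemma hyperplane_ofI:
  assumes "subspace V" "subspace H" "H \<subseteq> V" "w \<in> V" "w \<notin> H"
    and "\<And>x. x \<in> V \<Longrightarrow> \<exists>k. x - k *\<^sub>R w \<in> H"
  shows "hyperplane_of V H"
proof -
  have "V = span (insert w H)"
  proof
    show "V \<subseteq> span (insert w H)"
    proof
      fix x assume "x \<in> V"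
      with assms(6) obtain k where "x - k *\<^sub>R w \<in> H" by blast
      then have "x - k *\<^sub>R w \<in> span H" by (rule span_base)
      then show "x \<in> span (insert w H)" by (auto simp: span_breakdown_eq)
    qed
    show "span (insert w H) \<subseteq> V"
      using assms by (intro span_minimal) auto
  qed
  moreover have "w \<notin> span H"
    using assms(2,5) by (metis span_eq_iff)
  ultimately have "dim V = dim H + 1"
    using dim_insert[of w H] by simp
  then show ?thesis using assms by (simp add: hyperplane_of_def)
qed

lemma hyperplane_of_complement:
  assumes "hyperplane_of V H" "w \<in> V" "w \<notin> H" "x \<in> V"
  shows "\<exists>k. x - k *\<^sub>R w \<in> H"
proof -
  have H: "subspace V" "subspace H" "H \<subseteq> V" "dim H + 1 = dim V"
    using assms by (auto simp: hyperplane_of_def)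
  have sH: "span H = H" using H by simp
  have "dim (span (insert w H)) = dim V"
    using H assms dim_insert[of w H] by (simp add: sH)
  moreover have "span (insert w H) \<subseteq> V"
    using H assms by (intro span_minimal) auto
  ultimately have "span (insert w H) = V"
    using H by (intro subspace_dim_equal) auto
  then have "x \<in> span (insert w H)" using assms by simp
  then show ?thesis
    by (simp add: span_breakdown_eq sH)
qed

lemma hyperplane_of_proper:
  assumes "hyperplane_of V H" shows "\<not> V \<subseteq> H"
  using assms dim_subset[of V H] unfolding hyperplane_of_def by auto

lemma hyperplane_of_hyp:
  assumes "subspace V" "u \<in> V" "a \<bullet> u \<noteq> 0"
  shows "hyperplane_of V (hyp V a)"
proof (rule hyperplane_ofI[of _ _ u])
  show "subspace (hyp V a)"
    using assms(1) unfolding subspace_def hyp_def by (auto simp: inner_add_right)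
  fix x assume "x \<in> V"
  then have "x - ((a \<bullet> x) / (a \<bullet> u)) *\<^sub>R u \<in> hyp V a"
    using assms by (auto simp: hyp_def inner_diff_right subspace_diff subspace_mul)
  then show "\<exists>k. x - k *\<^sub>R u \<in> hyp V a" ..
qed (use assms in \<open>auto simp: hyp_def\<close>)

lemma hyp_Int_hyp: "hyp V a \<inter> hyp V b = hyp (hyp V b) a"
  by (auto simp: hyp_def)

lemma image_hyp_Int: "(\<lambda>H. H \<inter> hyp V b) ` hyp V ` R = hyp (hyp V b) ` R"
  by (simp add: image_image hyp_Int_hyp)

text \<open>The plane spanned by two test vectors meets the kernel of \<open>a\<close>; vanishing of \<open>b\<close> there is
  the vanishing of a \<open>2 \<times> 2\<close> minor.\<close>

lemma hyp_eq_minor: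
  assumes "subspace V" "hyp V a = hyp V b" "u \<in> V" "v \<in> V"
  shows "(a \<bullet> u) * (b \<bullet> v) = (a \<bullet> v) * (b \<bullet> u)"
proof -
  have "(a \<bullet> u) *\<^sub>R v - (a \<bullet> v) *\<^sub>R u \<in> hyp V a"
    using assms(1,3,4) unfolding hyp_def
    by (auto simp: subspace_diff subspace_mul inner_diff_right)
  then have "(a \<bullet> u) *\<^sub>R v - (a \<bullet> v) *\<^sub>R u \<in> hyp V b"
    using assms by simp
  then show ?thesis by (simp add: hyp_def inner_diff_right)
qed

lemma central_arrangement_hyperplane:
  "central_arrangement V A \<longleftrightarrow> subspace V \<and> finite A \<and> (\<forall>H\<in>A. hyperplane_of V H)"
  by (auto simp: central_arrangement_def hyperplane_of_def)

definition arr_center :: "'a::euclidean_space set \<Rightarrow> 'a set set \<Rightarrow> 'a set" where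
  "arr_center V A = V \<inter> \<Inter>A"

lemma subspace_arr_center:
  assumes "central_arrangement V A" shows "subspace (arr_center V A)"
  using assms unfolding central_arrangement_def arr_center_def
  by (auto intro!: subspace_inter subspace_Inter)

text \<open>A block of hyperplanes making the centre of \<open>A\<close> a modular coatom of \<open>A \<union> P\<close>.\<close>

definition modular_block :: "'a::euclidean_space set \<Rightarrow> 'a set set \<Rightarrow> 'a set set \<Rightarrow> bool" where
  "modular_block V A P \<longleftrightarrow> finite P \<and>
     (\<forall>H\<in>P. hyperplane_of V H \<and> \<not> arr_center V A \<subseteq> H) \<and>
     (\<forall>H\<in>P. \<forall>H'\<in>P. H \<noteq> H' \<longrightarrow> (\<exists>K\<in>A. H \<inter> H' = K \<inter> H'))"

text \<open>The vector \<open>u\<close> lies in the centre of the old arrangement and on no member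
  of the block. Comparing \<open>a\<close> with \<open>r\<close> only on the kernel of
  \<open>b\<close> also admits an \<open>r\<close> that is not a difference, as is needed after
  restriction.\<close>

lemma modular_block_hyp:
  assumes "subspace V" "u \<in> V" "finite P" "\<And>a. a \<in> R \<Longrightarrow> a \<bullet> u = 0" "\<And>a. a \<in> P \<Longrightarrow> a \<bullet> u \<noteq> 0"
    and "\<And>a b. a \<in> P \<Longrightarrow> b \<in> P \<Longrightarrow> a \<noteq> b \<Longrightarrow>
      \<exists>r\<in>R. \<forall>v\<in>V. b \<bullet> v = 0 \<longrightarrow> (a \<bullet> v = 0 \<longleftrightarrow> r \<bullet> v = 0)"
  shows "modular_block V (hyp V ` R) (hyp V ` P)"
  unfolding modular_block_def
proof (intro conjI ballI impI)
  show "finite (hyp V ` P)" using assms by simp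
next
  fix H assume "H \<in> hyp V ` P"
  then obtain a where a: "a \<in> P" "H = hyp V a" by auto
  then show "hyperplane_of V H" using assms hyperplane_of_hyp by blast
  have "u \<in> arr_center V (hyp V ` R)" "u \<notin> H"
    using a assms by (auto simp: arr_center_def hyp_def)
  then show "\<not> arr_center V (hyp V ` R) \<subseteq> H" by blast
next
  fix H H' assume "H \<in> hyp V ` P" "H' \<in> hyp V ` P" "H \<noteq> H'"
  then obtain a b where ab: "a \<in> P" "b \<in> P" "a \<noteq> b" "H = hyp V a" "H' = hyp V b" by auto
  then obtain r where "r \<in> R" "\<forall>v\<in>V. b \<bullet> v = 0 \<longrightarrow> (a \<bullet> v = 0 \<longleftrightarrow> r \<bullet> v = 0)"
    using assms(6) by blast
  then show "\<exists>K\<in>hyp V ` R. H \<inter> H' = K \<inter> H'"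
    using ab by (intro bexI[of _ "hyp V r"]) (auto simp: hyp_def)
qed

text \<open>A hyperplane \<open>H\<close> that does not contain the centre spans \<open>V\<close>
  together with it. Sums of flats and restrictions are both handled by moving vectors into
  \<open>H\<close> along the centre.\<close>

lemma modular_block_transversal:
  assumes "modular_block V A P" "central_arrangement V A" "H \<in> P" "v \<in> V"
  shows "\<exists>c\<in>arr_center V A. v - c \<in> H"
proof -
  from assms have "hyperplane_of V H" "\<not> arr_center V A \<subseteq> H"
    by (auto simp: modular_block_def)
  then obtain w where w: "w \<in> arr_center V A" "w \<notin> H" "hyperplane_of V H" by blast
  then have "w \<in> V" by (simp add: arr_center_def)
  with w assms obtain k where "v - k *\<^sub>R w \<in> H"
    using hyperplane_of_complement by blast
  moreover have "k *\<^sub>R w \<in> arr_center V A"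
    using w subspace_arr_center[OF assms(2)] by (simp add: subspace_mul)
  ultimately show ?thesis by blast
qed

text \<open>On one \<open>H\<close> of the block every other member agrees with a hyperplane of
  \<open>A\<close>, which contains the old centre anyway. So a nonempty block raises the rank by
  exactly one.\<close>

lemma modular_block_center_Int:
  assumes "modular_block V A P" "H \<in> P"
  shows "arr_center V (A \<union> P) = arr_center V A \<inter> H"
proof
  show "arr_center V (A \<union> P) \<subseteq> arr_center V A \<inter> H"
    using assms(2) unfolding arr_center_def by blast
  have "arr_center V A \<inter> H \<subseteq> H'" if H': "H' \<in> P" for H'
  proof (cases "H' = H")
    case False
    then obtain K where "K \<in> A" "H' \<inter> H = K \<inter> H"
      using assms H' unfolding modular_block_def by blast
    then show ?thesis by (auto simp: arr_center_def)
  qed auto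
  then show "arr_center V A \<inter> H \<subseteq> arr_center V (A \<union> P)"
    by (auto simp: arr_center_def)
qed

section \<open>Intersection lattices and modular chains\<close>

lemma arr_center_lattice: "X \<in> intersection_lattice V A \<Longrightarrow> arr_center V A \<subseteq> X"
  by (auto simp: intersection_lattice_def arr_center_def)

lemma intersection_lattice_mono: "A \<subseteq> A' \<Longrightarrow> intersection_lattice V A \<subseteq> intersection_lattice V A'"
  by (auto simp: intersection_lattice_def)

lemma intersection_lattice_subspace:
  "central_arrangement V A \<Longrightarrow> X \<in> intersection_lattice V A \<Longrightarrow> subspace X"
  unfolding intersection_lattice_def central_arrangement_def
  by (auto intro!: subspace_inter subspace_Inter)

lemma subspace_sum_absorb:
  assumes "subspace Y" "X \<subseteq> Y" "0 \<in> X" shows "X + Y = Y"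
proof
  show "X + Y \<subseteq> Y"
    using assms by (auto elim!: set_plus_elim intro: subspace_add)
  show "Y \<subseteq> X + Y"
    using assms(3) set_zero_plus2[of X Y] by simp
qed

lemma central_arrangement_Un_block:
  "central_arrangement V A \<Longrightarrow> modular_block V A P \<Longrightarrow> central_arrangement V (A \<union> P)"
  by (auto simp: central_arrangement_hyperplane modular_block_def)

text \<open>Once some \<open>H\<close> of the block takes part in an intersection, any further
  member can be exchanged for a hyperplane of \<open>A\<close> without changing what is cut out on
  \<open>H\<close>.\<close>

lemma modular_block_lattice:
  assumes "modular_block V A P" "Y \<in> intersection_lattice V (A \<union> P)"
  shows "Y \<in> intersection_lattice V A \<or> (\<exists>H\<in>P. \<exists>Z \<in> intersection_lattice V A. Y = Z \<inter> H)"
proof -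
  obtain B where B: "B \<subseteq> A \<union> P" "Y = V \<inter> \<Inter>B"
    using assms by (auto simp: intersection_lattice_def)
  show ?thesis
  proof (cases "B \<subseteq> A")
    case True
    then show ?thesis using B by (auto simp: intersection_lattice_def)
  next
    case False
    then obtain H where H: "H \<in> B" "H \<in> P" using B by blast
    have "\<forall>H'\<in>P - {H}. \<exists>K\<in>A. H' \<inter> H = K \<inter> H"
      using assms H by (auto simp: modular_block_def)
    then obtain K where K: "\<And>H'. H' \<in> P - {H} \<Longrightarrow> K H' \<in> A \<and> H' \<inter> H = K H' \<inter> H"
      by metis
    define C where "C = (B \<inter> A) \<union> K ` (B \<inter> P - {H})"
    have "C \<subseteq> A" using K by (auto simp: C_def)
    moreover have "Y = (V \<inter> \<Inter>C) \<inter> H"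
    proof
      show "Y \<subseteq> (V \<inter> \<Inter>C) \<inter> H"
        using B H K by (auto simp: C_def)
      show "(V \<inter> \<Inter>C) \<inter> H \<subseteq> Y"
      proof
        fix v assume v: "v \<in> (V \<inter> \<Inter>C) \<inter> H"
        have "v \<in> D" if D: "D \<in> B" for D
        proof -
          consider "D = H" | "D \<in> A" | "D \<in> P - {H}" using D B(1) by blast
          then show ?thesis
            using v D K[of D] by cases (auto simp: C_def)
        qed
        then show "v \<in> Y" using v B by auto
      qed
    qed
    moreover have "V \<inter> \<Inter>C \<in> intersection_lattice V A"
      using \<open>C \<subseteq> A\<close> unfolding intersection_lattice_def by blast
    ultimately show ?thesis using H(2) by blast
  qed
qed

text \<open>Cutting \<open>Z\<close> with \<open>H\<close> does not change its sum with
  \<open>X\<close>: a vector of the centre moves a given vector of \<open>Z\<close> into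
  \<open>H\<close>, and \<open>X\<close> absorbs the correction.\<close>

lemma modular_element_Un_block:
  assumes A: "central_arrangement V A" and P: "modular_block V A P"
    and X: "modular_element V A X"
  shows "modular_element V (A \<union> P) X"
  unfolding modular_element_def
proof (intro conjI ballI)
  have XA: "X \<in> intersection_lattice V A" using X by (simp add: modular_element_def)
  then show "X \<in> intersection_lattice V (A \<union> P)"
    using intersection_lattice_mono[of A "A \<union> P" V] by auto
  fix Y assume "Y \<in> intersection_lattice V (A \<union> P)"
  then consider "Y \<in> intersection_lattice V A"
    | H Z where "H \<in> P" "Z \<in> intersection_lattice V A" "Y = Z \<inter> H"
    using modular_block_lattice[OF P] by blast
  then have "X + Y \<in> intersection_lattice V A"
  proof cases
    case 1
    then show ?thesis using X by (simp add: modular_element_def)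
  next
    case 2
    note sub = intersection_lattice_subspace[OF A XA] intersection_lattice_subspace[OF A 2(2)]
    have "X + Y = X + Z"
    proof
      show "X + Y \<subseteq> X + Z" using 2 by (auto simp: set_plus_def)
      show "X + Z \<subseteq> X + Y"
      proof
        fix v assume "v \<in> X + Z"
        then obtain x z where xz: "x \<in> X" "z \<in> Z" "v = x + z" by (auto simp: set_plus_def)
        then have "z \<in> V" using 2 by (auto simp: intersection_lattice_def)
        then obtain c where c: "c \<in> arr_center V A" "z - c \<in> H"
          using modular_block_transversal[OF P A 2(1)] by blast
        then have "c \<in> X" "c \<in> Z" using arr_center_lattice XA 2 by blast+
        then have "x + c \<in> X" "z - c \<in> Y" "v = (x + c) + (z - c)"
          using xz sub c 2 by (auto intro: subspace_add subspace_diff)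
        then show "v \<in> X + Y" by (metis set_plus_intro)
      qed
    qed
    then show ?thesis using X 2 by (simp add: modular_element_def)
  qed
  then show "X + Y \<in> intersection_lattice V (A \<union> P)"
    using intersection_lattice_mono[of A "A \<union> P" V] by auto
qed

lemma modular_element_center:
  assumes "central_arrangement V A" shows "modular_element V A (arr_center V A)"
  unfolding modular_element_def
proof (intro conjI ballI)
  show "arr_center V A \<in> intersection_lattice V A"
    by (auto simp: arr_center_def intersection_lattice_def)
  fix Y assume Y: "Y \<in> intersection_lattice V A"
  have "arr_center V A + Y = Y"
    using intersection_lattice_subspace[OF assms Y] arr_center_lattice[OF Y]
      subspace_arr_center[OF assms]
    by (intro subspace_sum_absorb) (auto simp: subspace_0)
  then show "arr_center V A + Y \<in> intersection_lattice V A" using Y by simp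
qed

lemma supersolvable_empty: "subspace V \<Longrightarrow> supersolvable V {}"
  unfolding supersolvable_def
  using modular_element_center[of V "{}"]
  by (intro exI[of _ "\<lambda>_. V"] exI[of _ "0 :: nat"])
     (auto simp: arr_center_def central_arrangement_def)

lemma hyperplane_of_Int:
  assumes "hyperplane_of V H" "subspace W" "W \<subseteq> V" "\<not> W \<subseteq> H"
  shows "hyperplane_of W (H \<inter> W)"
proof -
  obtain w where w: "w \<in> W" "w \<notin> H" using assms by blast
  show ?thesis
  proof (rule hyperplane_ofI[of _ _ w])
    fix x assume x: "x \<in> W"
    then obtain k where "x - k *\<^sub>R w \<in> H"
      using hyperplane_of_complement[OF assms(1), of w x] w assms by blast
    moreover have "x - k *\<^sub>R w \<in> W" using x w assms by (simp add: subspace_diff subspace_mul)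
    ultimately show "\<exists>k. x - k *\<^sub>R w \<in> H \<inter> W" by blast
  qed (use assms w in \<open>auto simp: hyperplane_of_def subspace_inter\<close>)
qed

text \<open>The modular chain of \<open>A\<close> is prolonged by one step, to the new centre. That
  step is a covering because its codimension is one; the old steps stay coverings because no new
  flat slips in between.\<close>

lemma supersolvable_Un_block:
  assumes S: "supersolvable V A" and A: "central_arrangement V A" and P: "modular_block V A P"
  shows "supersolvable V (A \<union> P)"
proof (cases "P = {}")
  case True
  then show ?thesis using S by simp
next
  case False
  then obtain H where H: "H \<in> P" by blast
  let ?C = "arr_center V A" and ?C' = "arr_center V (A \<union> P)"
  have AP: "central_arrangement V (A \<union> P)" using A P by (rule central_arrangement_Un_block)
  from S obtain X r where X: "X 0 = V" "X r = ?C" "\<And>i. i \<le> r \<Longrightarrow> modular_element V A (X i)"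
      "\<And>i. i < r \<Longrightarrow> X (Suc i) \<subset> X i"
      "\<And>i Y. i < r \<Longrightarrow> Y \<in> intersection_lattice V A \<Longrightarrow> \<not> (X (Suc i) \<subset> Y \<and> Y \<subset> X i)"
    unfolding supersolvable_def arr_center_def by metis
  have CC: "?C' = ?C \<inter> H" using P H by (rule modular_block_center_Int)
  have hC: "hyperplane_of ?C ?C'"
    unfolding CC Int_commute[of ?C]
    using hyperplane_of_Int[of V H ?C] P H subspace_arr_center[OF A]
    by (auto simp: modular_block_def arr_center_def)
  define X' where "X' = X(Suc r := ?C')"
  have X'0: "X' 0 = V" and X'r: "X' (Suc r) = ?C'" using X by (auto simp: X'_def)
  have X'm: "modular_element V (A \<union> P) (X' i)" if "i \<le> Suc r" for i
  proof (cases "i = Suc r")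
    case True
    then show ?thesis using modular_element_center[OF AP] by (simp add: X'_def)
  next
    case False
    then show ?thesis
      using that X(3)[of i] modular_element_Un_block[OF A P] by (auto simp: X'_def)
  qed
  have X'c: "X' (Suc i) \<subset> X' i \<and>
      \<not> (\<exists>Y \<in> intersection_lattice V (A \<union> P). X' (Suc i) \<subset> Y \<and> Y \<subset> X' i)" if "i < Suc r" for i
  proof (cases "i = r")
    case True
    have "?C' \<subset> ?C" using hC hyperplane_of_proper[OF hC] by (auto simp: hyperplane_of_def)
    \<comment> \<open>A vector of \<open>Y\<close> outside the hyperplane \<open>?C'\<close> of
      \<open>?C\<close> generates \<open>?C\<close> together with \<open>?C'\<close>.\<close>
    moreover have False if Y: "Y \<in> intersection_lattice V (A \<union> P)" "?C' \<subset> Y" "Y \<subset> ?C" for Y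
    proof -
      have "subspace Y" using intersection_lattice_subspace[OF AP Y(1)] .
      obtain w where w: "w \<in> Y" "w \<notin> ?C'" using Y(2) by blast
      have "?C \<subseteq> Y"
      proof
        fix x assume x: "x \<in> ?C"
        then obtain k where k: "x - k *\<^sub>R w \<in> ?C'"
          using hyperplane_of_complement[OF hC, of w x] w Y by blast
        then have "x - k *\<^sub>R w \<in> Y" using Y by blast
        then have "(x - k *\<^sub>R w) + k *\<^sub>R w \<in> Y"
          using w \<open>subspace Y\<close> by (intro subspace_add subspace_mul) auto
        then show "x \<in> Y" by simp
      qed
      then show False using Y by blast
    qed
    ultimately show ?thesis using True X by (auto simp: X'_def)
  next
    case False
    then have i: "i < r" using that by simp
    \<comment> \<open>A flat above an old member of the chain contains the old centre, which no
      member of the block does; hence it is cut out by \<open>A\<close> alone.\<close>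
    have "Y \<in> intersection_lattice V A"
      if Y: "Y \<in> intersection_lattice V (A \<union> P)" and XY: "X (Suc i) \<subset> Y" for Y
    proof -
      have "?C \<subseteq> X (Suc i)"
        using X(3)[of "Suc i"] i arr_center_lattice by (auto simp: modular_element_def)
      then have CY: "?C \<subseteq> Y" using XY by blast
      from Y obtain B where B: "B \<subseteq> A \<union> P" "Y = V \<inter> \<Inter>B"
        by (auto simp: intersection_lattice_def)
      have "B \<subseteq> A"
      proof
        fix D assume "D \<in> B"
        then have "?C \<subseteq> D" "D \<in> A \<union> P" using CY B by auto
        then show "D \<in> A" using P by (auto simp: modular_block_def)
      qed
      then show ?thesis using B by (auto simp: intersection_lattice_def)
    qed
    then show ?thesis
      using i X(4)[of i] X(5)[of i] by (auto simp: X'_def)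
  qed
  have "X' 0 = V \<and> X' (Suc r) = V \<inter> \<Inter>(A \<union> P) \<and>
    (\<forall>i\<le>Suc r. modular_element V (A \<union> P) (X' i)) \<and>
    (\<forall>i<Suc r. X' (Suc i) \<subset> X' i \<and>
      \<not> (\<exists>Y \<in> intersection_lattice V (A \<union> P). X' (Suc i) \<subset> Y \<and> Y \<subset> X' i))"
    using X'0 X'r[unfolded arr_center_def] X'm X'c by (intro conjI allI impI) (assumption | rule X'm X'c | blast)+
  then show ?thesis
    unfolding supersolvable_def by (intro exI)
qed

section \<open>Inductively factored arrangements\<close>

lemma inductively_factored_pair_wf:
  "inductively_factored_pair V A \<pi> \<Longrightarrow> central_arrangement V A \<and> ordered_partition A \<pi>"
proof (induction rule: inductively_factored_pair.induct)
  case (renumber V A \<pi> \<pi>')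
  then show ?case
    unfolding ordered_partition_def by (metis mset_eq_imp_distinct_iff mset_eq_setD)
qed (auto simp: central_arrangement_def ordered_partition_def partition_on_def)

lemma map_filter_nonempty_image:
  "map ((`) f) (filter (\<lambda>B. B \<noteq> {}) Bs) = filter (\<lambda>B. B \<noteq> {}) (map ((`) f) Bs)"
  by (induction Bs) auto

text \<open>If \<open>W\<close> and the centre span \<open>V\<close>, intersecting with
  \<open>W\<close> loses nothing, since each vector of a hyperplane \<open>H\<close> is one of
  \<open>H \<inter> W\<close> plus one of the centre. \<open>W\<close> varies in the induction
  because restriction to \<open>H0\<close> replaces it by \<open>H0 \<inter> W\<close>.\<close>

lemma inductively_factored_pair_transversal:
  assumes "inductively_factored_pair V A \<pi>" "subspace W" "W \<subseteq> V"
    "\<And>v. v \<in> V \<Longrightarrow> \<exists>c\<in>arr_center V A. v - c \<in> W"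
  shows "inductively_factored_pair W ((\<lambda>H. H \<inter> W) ` A) (map ((`) (\<lambda>H. H \<inter> W)) \<pi>)"
  using assms
proof (induction arbitrary: W rule: inductively_factored_pair.induct)
  case (empty V)
  then show ?case by (simp add: inductively_factored_pair.empty)
next
  case (renumber V A \<pi> \<pi>')
  then show ?case
    using inductively_factored_pair.renumber by (metis mset_map)
next
  case (step V A P Ps H0 A' A'')
  let ?r = "\<lambda>H. H \<inter> W"
  note W = step.prems
  have hV: "hyperplane_of V H" if "H \<in> A" for H
    using step.hyps(1) that by (simp add: central_arrangement_hyperplane)
  have part: "P \<union> \<Union>(set Ps) = A" "{} \<notin> insert P (set Ps)" "P \<notin> set Ps"
     "distinct Ps" "disjoint (insert P (set Ps))"
    using step.hyps(2) by (auto simp: ordered_partition_def partition_on_def)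
  have H0: "H0 \<in> A" using step.hyps(3) part by blast
  \<comment> \<open>This splitting carries inclusions from \<open>W\<close> back to
    \<open>V\<close>; injectivity on \<open>A\<close> and the bijection of rule \<open>step\<close>
    both rest on it.\<close>
  have recover: "\<exists>h\<in>H \<inter> W. \<exists>c\<in>arr_center V A. v = h + c" if "H \<in> A" "v \<in> H" for H v
  proof -
    have "v \<in> V" using that hV by (auto simp: hyperplane_of_def)
    then obtain c where c: "c \<in> arr_center V A" "v - c \<in> W" using W(3) by blast
    then have "c \<in> H" using that by (auto simp: arr_center_def)
    then have "v - c \<in> H" using that hV by (auto simp: hyperplane_of_def intro: subspace_diff)
    then show ?thesis using c by (intro bexI[of _ "v - c"] bexI[of _ c]) auto
  qed
  have recover_sub: "H \<subseteq> K" if "H \<in> A" "K \<in> A" "H \<inter> W \<subseteq> K" for H K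
  proof
    fix v assume "v \<in> H"
    then obtain h c where "h \<in> H \<inter> W" "c \<in> arr_center V A" "v = h + c"
      using recover \<open>H \<in> A\<close> by blast
    then show "v \<in> K"
      using that hV[of K] by (auto simp: arr_center_def hyperplane_of_def intro: subspace_add)
  qed
  have inj: "inj_on ?r A"
  proof (rule inj_onI)
    fix H K assume "H \<in> A" "K \<in> A" "H \<inter> W = K \<inter> W"
    then show "H = K" using recover_sub[of H K] recover_sub[of K H] by blast
  qed
  have A'r: "?r ` A' = ?r ` A - {H0 \<inter> W}"
    using inj H0 unfolding step.hyps(4) by (subst inj_on_image_set_diff[of _ A]) auto
  have A''r: "(\<lambda>H. H \<inter> (H0 \<inter> W)) ` A'' = (\<lambda>H. H \<inter> (H0 \<inter> W)) ` (?r ` A')"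
    unfolding step.hyps(5) image_image by (rule image_cong) auto
  have cW: "central_arrangement W (?r ` A)"
    unfolding central_arrangement_hyperplane
  proof (intro conjI ballI)
    show "finite (?r ` A)" using step.hyps(1) by (simp add: central_arrangement_def)
    fix K assume "K \<in> ?r ` A"
    then obtain H where H: "H \<in> A" "K = H \<inter> W" by blast
    have "\<not> W \<subseteq> H"
    proof
      assume "W \<subseteq> H"
      have "V \<subseteq> H"
      proof
        fix v assume "v \<in> V"
        then obtain c where c: "c \<in> arr_center V A" "v - c \<in> W" using W(3) by blast
        then have "c \<in> H" "v - c \<in> H" using H \<open>W \<subseteq> H\<close> by (auto simp: arr_center_def)
        then have "v - c + c \<in> H" using hV[OF H(1)]
          by (intro subspace_add) (auto simp: hyperplane_of_def)
        then show "v \<in> H" by simp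
      qed
      then show False using hyperplane_of_proper hV H by blast
    qed
    then show "hyperplane_of W K" using hyperplane_of_Int hV H W by blast
  qed (use W in auto)
  have sub: "P \<subseteq> A" "\<And>B. B \<in> set Ps \<Longrightarrow> B \<subseteq> A" using part by auto
  have inj_img: "B = C" if "?r ` B = ?r ` C" "B \<subseteq> A" "C \<subseteq> A" for B C
    using that(1) inj_on_image_eq_iff[OF inj that(2,3)] by blast
  have "inj_on ((`) ?r) (set (P # Ps))"
  proof (rule inj_onI)
    fix B C assume "B \<in> set (P # Ps)" "C \<in> set (P # Ps)" "?r ` B = ?r ` C"
    then show "B = C" using sub inj_img[of B C] by auto
  qed
  then have "distinct (map ((`) ?r) (P # Ps))"
    using part(3,4) unfolding distinct_map by simp
  moreover have "partition_on (?r ` A) (set (map ((`) ?r) (P # Ps)))"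
    unfolding partition_on_def
  proof (intro conjI)
    show "\<Union>(set (map ((`) ?r) (P # Ps))) = ?r ` A" using part(1) by auto
    show "{} \<notin> set (map ((`) ?r) (P # Ps))" using part(2) by auto
    show "disjoint (set (map ((`) ?r) (P # Ps)))"
    proof (rule disjointI)
      fix X Y assume "X \<in> set (map ((`) ?r) (P # Ps))" "Y \<in> set (map ((`) ?r) (P # Ps))" "X \<noteq> Y"
      then obtain B C where BC: "B \<in> insert P (set Ps)" "C \<in> insert P (set Ps)" "B \<noteq> C"
         "X = ?r ` B" "Y = ?r ` C" by auto
      then have "B \<inter> C = {}" using part(5) by (simp add: disjointD)
      moreover have "B \<subseteq> A" "C \<subseteq> A" using BC sub by auto
      ultimately show "X \<inter> Y = {}"
        using inj_on_image_Int[OF inj, of B C] BC by simp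
    qed
  qed
  ultimately have oW: "ordered_partition (?r ` A) (?r ` P # map ((`) ?r) Ps)"
    by (simp add: ordered_partition_def)
  \<comment> \<open>Deletion can only enlarge the centre, so \<open>W\<close> stays
    transversal.\<close>
  have cen: "arr_center V A \<subseteq> arr_center V A'" using step.hyps(4) by (auto simp: arr_center_def)
  have IH1: "inductively_factored_pair W (?r ` A')
      (map ((`) ?r) (filter (\<lambda>B. B \<noteq> {}) (map (\<lambda>B. B \<inter> A') (P # Ps))))"
    using W cen by (intro step.IH(1)) blast+
  have "map ((`) ?r) (filter (\<lambda>B. B \<noteq> {}) (map (\<lambda>B. B \<inter> A') (P # Ps))) =
      filter (\<lambda>B. B \<noteq> {}) (map (\<lambda>B. ?r ` (B \<inter> A')) (P # Ps))"
    unfolding map_filter_nonempty_image map_map o_def ..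
  also have "map (\<lambda>B. ?r ` (B \<inter> A')) (P # Ps) = map (\<lambda>B. B \<inter> ?r ` A') (?r ` P # map ((`) ?r) Ps)"
  proof -
    have "?r ` (B \<inter> A') = ?r ` B \<inter> ?r ` A'" if "B \<subseteq> A" for B
      using inj that by (rule inj_on_image_Int) (auto simp: step.hyps(4))
    then show ?thesis using sub by simp
  qed
  finally have p1: "inductively_factored_pair W (?r ` A')
      (filter (\<lambda>B. B \<noteq> {}) (map (\<lambda>B. B \<inter> ?r ` A') (?r ` P # map ((`) ?r) Ps)))"
    using IH1 by simp
  have hH0: "hyperplane_of V H0" using hV H0 by blast
  have p2': "inductively_factored_pair (H0 \<inter> W) ((\<lambda>H. H \<inter> (H0 \<inter> W)) ` A'')
      (map ((`) (\<lambda>H. H \<inter> (H0 \<inter> W))) (map (\<lambda>B. (\<lambda>H. H \<inter> H0) ` B) Ps))"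
  proof (rule step.IH(2))
    show "subspace (H0 \<inter> W)" using hH0 W by (auto simp: hyperplane_of_def subspace_inter)
    fix v assume "v \<in> H0"
    then obtain h c where hc: "h \<in> H0 \<inter> W" "c \<in> arr_center V A" "v = h + c"
      using recover H0 by blast
    \<comment> \<open>The centre of \<open>A\<close> lies in \<open>H0\<close>, hence in the centre
      of the restriction.\<close>
    then have "c \<in> arr_center H0 A''"
      using H0 by (auto simp: arr_center_def step.hyps(4,5))
    then show "\<exists>c\<in>arr_center H0 A''. v - c \<in> H0 \<inter> W"
      using hc by (intro bexI[of _ c]) auto
  qed auto
  have eq: "map ((`) (\<lambda>H. H \<inter> (H0 \<inter> W))) (map (\<lambda>B. (\<lambda>H. H \<inter> H0) ` B) Ps) =
     map (\<lambda>B. (\<lambda>H. H \<inter> (H0 \<inter> W)) ` B) (map ((`) ?r) Ps)"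
    by (auto simp: image_image intro!: map_cong image_cong)
  have p2: "inductively_factored_pair (H0 \<inter> W) ((\<lambda>H. H \<inter> (H0 \<inter> W)) ` (?r ` A'))
     (map (\<lambda>B. (\<lambda>H. H \<inter> (H0 \<inter> W)) ` B) (map ((`) ?r) Ps))"
    using p2' unfolding eq A''r .
  have bij: "bij_betw (\<lambda>H. H \<inter> (H0 \<inter> W)) (?r ` A - ?r ` P) ((\<lambda>H. H \<inter> (H0 \<inter> W)) ` (?r ` A'))"
    unfolding bij_betw_def
  proof
    have diff: "?r ` A - ?r ` P = ?r ` (A - P)"
      using inj sub by (simp add: inj_on_image_set_diff[of _ A])
    have b: "inj_on (\<lambda>H. H \<inter> H0) (A - P)" "(\<lambda>H. H \<inter> H0) ` (A - P) = (\<lambda>H. H \<inter> H0) ` A'"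
      using step.hyps(6) unfolding step.hyps(5) bij_betw_def by auto
    show "inj_on (\<lambda>H. H \<inter> (H0 \<inter> W)) (?r ` A - ?r ` P)"
      unfolding diff
    proof (rule inj_onI, clarify)
      fix H K assume HK: "H \<in> A" "H \<notin> P" "K \<in> A" "K \<notin> P" "H \<inter> W \<inter> (H0 \<inter> W) = K \<inter> W \<inter> (H0 \<inter> W)"
      have *: "H \<inter> H0 \<subseteq> K" if HK: "H \<in> A" "K \<in> A" "H \<inter> W \<inter> (H0 \<inter> W) \<subseteq> K" for H K
      proof
        fix v assume v: "v \<in> H \<inter> H0"
        then obtain h c where hc: "h \<in> H0 \<inter> W" "c \<in> arr_center V A" "v = h + c"
          using recover H0 by blast
        then have c: "c \<in> H" "c \<in> K" using HK by (auto simp: arr_center_def)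
        have "v - c \<in> H" using v c hV[OF HK(1)] by (auto simp: hyperplane_of_def intro!: subspace_diff)
        then have "h \<in> K" using hc HK(3) by auto
        then show "v \<in> K" using hc c hV[OF HK(2)] by (auto simp: hyperplane_of_def intro: subspace_add)
      qed
      have "H \<inter> H0 = K \<inter> H0" using *[of H K] *[of K H] HK by blast
      then have "H = K" using b(1) HK by (auto dest: inj_onD)
      then show "H \<inter> W = K \<inter> W" by simp
    qed
    have "(\<lambda>H. H \<inter> (H0 \<inter> W)) ` ?r ` (A - P) = (\<lambda>H. H \<inter> W) ` (\<lambda>H. H \<inter> H0) ` (A - P)"
      unfolding image_image by (intro image_cong) auto
    also have "\<dots> = (\<lambda>H. H \<inter> (H0 \<inter> W)) ` ?r ` A'"
      unfolding b(2) unfolding image_image by (intro image_cong) auto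
    finally show "(\<lambda>H. H \<inter> (H0 \<inter> W)) ` (?r ` A - ?r ` P) = (\<lambda>H. H \<inter> (H0 \<inter> W)) ` ?r ` A'"
      unfolding diff .
  qed
  have "inductively_factored_pair W (?r ` A) (?r ` P # map ((`) ?r) Ps)"
    using cW oW _ A'r refl bij p1 p2
    by (rule inductively_factored_pair.step) (use step.hyps(3) in blast)
  then show ?case by simp
qed

text \<open>Rule \<open>step\<close> read upwards: \<open>H\<^sub>0\<close> joins a block
  \<open>Q\<close>, which may be empty, whence the filter. On \<open>H\<^sub>0\<close> the members
  of \<open>Q\<close> coincide with hyperplanes of other blocks, so the other blocks alone give the
  whole restriction, and injectivity on them is the required bijection.\<close>

lemma inductively_factored_addition:
  assumes A': "inductively_factored_pair V A' (filter (\<lambda>B. B \<noteq> {}) (Q # Ps))"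
    and ne: "{} \<notin> set Ps"
    and H0: "hyperplane_of V H\<^sub>0" "H\<^sub>0 \<notin> A'"
    and Q: "\<And>H. H \<in> Q \<Longrightarrow> \<exists>K\<in>\<Union>(set Ps). H \<inter> H\<^sub>0 = K \<inter> H\<^sub>0"
    and inj: "inj_on (\<lambda>H. H \<inter> H\<^sub>0) (\<Union>(set Ps))"
    and A'': "inductively_factored_pair H\<^sub>0 ((\<lambda>H. H \<inter> H\<^sub>0) ` A') (map ((`) (\<lambda>H. H \<inter> H\<^sub>0)) Ps)"
  shows "inductively_factored_pair V (insert H\<^sub>0 A') (insert H\<^sub>0 Q # Ps)"
proof -
  have "central_arrangement V A'" and op: "ordered_partition A' (filter (\<lambda>B. B \<noteq> {}) (Q # Ps))"
    using inductively_factored_pair_wf[OF A'] by auto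
  have fPs: "filter (\<lambda>B. B \<noteq> {}) Ps = Ps" using ne by (auto simp: filter_id_conv)
  have un: "Q \<union> \<Union>(set Ps) = A'" and d: "distinct Ps" and dj: "disjoint (set Ps)"
    and QP: "\<And>B. B \<in> set Ps \<Longrightarrow> Q \<inter> B = {}"
    using op fPs by (auto simp: ordered_partition_def partition_on_def disjoint_def split: if_splits)
  have notin: "H\<^sub>0 \<notin> B" if "B \<in> set Ps" for B using un H0 that by blast
  have o: "ordered_partition (insert H\<^sub>0 A') (insert H\<^sub>0 Q # Ps)"
    unfolding ordered_partition_def partition_on_def
  proof (intro conjI)
    show "distinct (insert H\<^sub>0 Q # Ps)" using d notin by auto
    show "\<Union>(set (insert H\<^sub>0 Q # Ps)) = insert H\<^sub>0 A'" using un by auto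
    show "disjoint (set (insert H\<^sub>0 Q # Ps))"
      using dj QP notin by (auto simp: disjoint_def)
    show "{} \<notin> set (insert H\<^sub>0 Q # Ps)" using ne by auto
  qed
  have c: "central_arrangement V (insert H\<^sub>0 A')"
    using \<open>central_arrangement V A'\<close> H0 by (simp add: central_arrangement_hyperplane)
  have del: "A' = insert H\<^sub>0 A' - {H\<^sub>0}" using H0 by auto
  have b: "bij_betw (\<lambda>H. H \<inter> H\<^sub>0) (insert H\<^sub>0 A' - insert H\<^sub>0 Q) ((\<lambda>H. H \<inter> H\<^sub>0) ` A')"
  proof -
    have "insert H\<^sub>0 A' - insert H\<^sub>0 Q = \<Union>(set Ps)" using un QP notin by blast
    moreover have "(\<lambda>H. H \<inter> H\<^sub>0) ` \<Union>(set Ps) = (\<lambda>H. H \<inter> H\<^sub>0) ` A'"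
      using un Q by blast
    ultimately show ?thesis using inj by (simp add: bij_betw_def)
  qed
  have m: "map (\<lambda>B. B \<inter> A') (insert H\<^sub>0 Q # Ps) = Q # Ps"
    using un H0 by (auto intro!: map_idI)
  show ?thesis
    by (rule inductively_factored_pair.step[OF c o insertI1 del refl b _ A'']) (simp only: m A')
qed

text \<open>The members of \<open>P\<close> are added one at a time to a single new block. Those
  added earlier restrict to hyperplanes of \<open>A\<close>, so every restriction is that of
  \<open>A\<close>, whose factorization survives by transversality to the centre.\<close>

lemma inductively_factored_Un_block:
  assumes A: "inductively_factored_pair V A (filter (\<lambda>B. B \<noteq> {}) \<pi>)" and P: "modular_block V A P"
  shows "inductively_factored_pair V (A \<union> P) (filter (\<lambda>B. B \<noteq> {}) (P # \<pi>))"
proof -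
  have cA: "central_arrangement V A" and op: "ordered_partition A (filter (\<lambda>B. B \<noteq> {}) \<pi>)"
    using inductively_factored_pair_wf[OF A] by auto
  have un: "\<Union>(set (filter (\<lambda>B. B \<noteq> {}) \<pi>)) = A"
    using op by (auto simp: ordered_partition_def partition_on_def)
  have "finite P" using P by (simp add: modular_block_def)
  then show ?thesis using P
  proof (induction P rule: finite_induct)
    case empty
    then show ?case using A by simp
  next
    case (insert H0 P)
    have P: "modular_block V A P" using insert.prems by (auto simp: modular_block_def)
    have H0: "hyperplane_of V H0" "\<not> arr_center V A \<subseteq> H0"
      using insert.prems by (auto simp: modular_block_def)
    then have sH0: "subspace H0" "H0 \<subseteq> V" by (auto simp: hyperplane_of_def)
    have notin: "H0 \<notin> A" using H0(2) by (auto simp: arr_center_def)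
    have pairs: "\<exists>K\<in>A. H \<inter> H0 = K \<inter> H0" if "H \<in> P" for H
    proof -
      have "H \<noteq> H0" using that insert.hyps by blast
      then show ?thesis using insert.prems that unfolding modular_block_def by simp
    qed
    have trans: "\<exists>c\<in>arr_center V A. v - c \<in> H0" if "v \<in> V" for v
      using modular_block_transversal[OF insert.prems cA insertI1 that] .
    have "inductively_factored_pair V (insert H0 (A \<union> P)) (insert H0 P # filter (\<lambda>B. B \<noteq> {}) \<pi>)"
    proof (rule inductively_factored_addition)
      \<comment> \<open>Before its first member is added the new block is empty and is filtered
        out.\<close>
      show "inductively_factored_pair V (A \<union> P) (filter (\<lambda>B. B \<noteq> {}) (P # filter (\<lambda>B. B \<noteq> {}) \<pi>))"
        using insert.IH[OF P] by (cases "P = {}") simp_all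
      show "inj_on (\<lambda>H. H \<inter> H0) (\<Union> (set (filter (\<lambda>B. B \<noteq> {}) \<pi>)))"
        unfolding un
      proof (rule inj_onI)
        have *: "H \<subseteq> K" if HK: "H \<in> A" "K \<in> A" "H \<inter> H0 \<subseteq> K" for H K
        proof
          fix v assume v: "v \<in> H"
          have sub: "subspace H" "subspace K" "H \<subseteq> V"
            using HK cA by (auto simp: central_arrangement_def)
          then obtain c where c: "c \<in> arr_center V A" "v - c \<in> H0" using trans v by blast
          then have cHK: "c \<in> H" "c \<in> K" using HK by (auto simp: arr_center_def)
          then have "v - c \<in> K" using c HK(3) v sub subspace_diff by blast
          then have "v - c + c \<in> K" using cHK sub by (intro subspace_add)
          then show "v \<in> K" by simp
        qed
        fix H K assume "H \<in> A" "K \<in> A" "H \<inter> H0 = K \<inter> H0"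
        then show "H = K" using *[of H K] *[of K H] by blast
      qed
      have "(\<lambda>H. H \<inter> H0) ` (A \<union> P) = (\<lambda>H. H \<inter> H0) ` A"
        using pairs by blast
      then show "inductively_factored_pair H0 ((\<lambda>H. H \<inter> H0) ` (A \<union> P))
          (map ((`) (\<lambda>H. H \<inter> H0)) (filter (\<lambda>B. B \<noteq> {}) \<pi>))"
        using inductively_factored_pair_transversal[OF A sH0 trans] by simp
    qed (use H0 notin insert.hyps pairs un in auto)
    then show ?case by simp
  qed
qed

lemma filter_nonempty_factored:
  "inductively_factored_pair V A \<pi> \<Longrightarrow> filter (\<lambda>B. B \<noteq> {}) \<pi> = \<pi>"
  using inductively_factored_pair_wf[of V A \<pi>]
  by (auto simp: ordered_partition_def partition_on_def filter_id_conv)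

text \<open>On the kernel of \<open>b\<close> the functionals \<open>a\<close> and
  \<open>a - b\<close> agree, so the difference supplies the third hyperplane.\<close>

lemma modular_block_differences:
  assumes "subspace V" "u \<in> V" "finite P" "\<And>a. a \<in> R \<Longrightarrow> a \<bullet> u = 0" "\<And>a. a \<in> P \<Longrightarrow> a \<bullet> u \<noteq> 0"
    and "\<And>a b. a \<in> P \<Longrightarrow> b \<in> P \<Longrightarrow> a \<noteq> b \<Longrightarrow> a - b \<in> R \<or> b - a \<in> R"
  shows "modular_block V (hyp V ` R) (hyp V ` P)"
proof (rule modular_block_hyp[OF assms(1-5)])
  fix a b assume "a \<in> P" "b \<in> P" "a \<noteq> b"
  then have "a - b \<in> R \<or> b - a \<in> R" by (rule assms(6))
  then show "\<exists>r\<in>R. \<forall>v\<in>V. b \<bullet> v = 0 \<longrightarrow> (a \<bullet> v = 0 \<longleftrightarrow> r \<bullet> v = 0)"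
  proof
    assume "a - b \<in> R"
    then show ?thesis by (intro bexI[of _ "a - b"]) (auto simp: inner_diff_left)
  next
    assume "b - a \<in> R"
    then show ?thesis by (intro bexI[of _ "b - a"]) (auto simp: inner_diff_left)
  qed
qed

lemma inductively_factored_hyp_Un:
  assumes "inductively_factored_pair V (hyp V ` S) (filter (\<lambda>B. B \<noteq> {}) \<pi>)"
    and "modular_block V (hyp V ` S) (hyp V ` P)"
  shows "inductively_factored_pair V (hyp V ` (S \<union> P)) (filter (\<lambda>B. B \<noteq> {}) (hyp V ` P # \<pi>))"
  using inductively_factored_Un_block[OF assms] by (simp add: image_Un)

section \<open>The star with three arms\<close>

text \<open>With \<open>c + y + z\<close> absent, \<open>c + z + x\<close> is the only root of
  height 3 in the block of \<open>z\<close>. Up to sign the differences in the block of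
  \<open>x\<close> are \<open>c\<close>, \<open>y\<close>, \<open>c + y\<close>, and those in the
  block of \<open>z\<close> are \<open>c\<close>, \<open>x\<close>, \<open>c + x\<close>; hence the
  order \<open>c\<close>, \<open>y\<close>, \<open>x\<close>, \<open>z\<close>.\<close>

lemma star_factored_missing:
  assumes V: "subspace V"
    and co: "\<And>p q r s. \<exists>v\<in>V. c \<bullet> v = p \<and> x \<bullet> v = q \<and> y \<bullet> v = r \<and> z \<bullet> v = s"
    and R: "R \<subseteq> {c, x, c + x, y, c + y, c + x + y, z, c + z, c + z + x}"
    and cl: "c + x \<in> R \<Longrightarrow> c \<in> R \<and> x \<in> R" "c + y \<in> R \<Longrightarrow> c \<in> R \<and> y \<in> R"
      "c + z \<in> R \<Longrightarrow> c \<in> R \<and> z \<in> R" "c + x + y \<in> R \<Longrightarrow> c + x \<in> R \<and> c + y \<in> R"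
      "c + z + x \<in> R \<Longrightarrow> c + z \<in> R \<and> c + x \<in> R"
  shows "inductively_factored_pair V (hyp V ` R) (filter (\<lambda>B. B \<noteq> {})
    [hyp V ` (R \<inter> {z, c + z, c + z + x}), hyp V ` (R \<inter> {x, c + x, c + x + y}),
     hyp V ` (R \<inter> {y, c + y}), hyp V ` (R \<inter> {c})])"
proof -
  \<comment> \<open>Dual vectors: each vanishes on the blocks added before its own and is nonzero on
    its own block.\<close>
  obtain ec where ec: "ec \<in> V" "c \<bullet> ec = 1" "x \<bullet> ec = 0" "y \<bullet> ec = 0" "z \<bullet> ec = 0" using co by blast
  obtain ex where ex: "ex \<in> V" "c \<bullet> ex = 0" "x \<bullet> ex = 1" "y \<bullet> ex = 0" "z \<bullet> ex = 0" using co by blast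
  obtain ey where ey: "ey \<in> V" "c \<bullet> ey = 0" "x \<bullet> ey = 0" "y \<bullet> ey = 1" "z \<bullet> ey = 0" using co by blast
  obtain ez where ez: "ez \<in> V" "c \<bullet> ez = 0" "x \<bullet> ez = 0" "y \<bullet> ez = 0" "z \<bullet> ez = 1" using co by blast
  let ?S0 = "{} :: 'a set" and ?B1 = "R \<inter> {c}" and ?B2 = "R \<inter> {y, c + y}"
    and ?B3 = "R \<inter> {x, c + x, c + x + y}" and ?B4 = "R \<inter> {z, c + z, c + z + x}"
  have "inductively_factored_pair V (hyp V ` {}) (filter (\<lambda>B. B \<noteq> {}) [])"
    using inductively_factored_pair.empty[OF V] by simp
  then have 1: "inductively_factored_pair V (hyp V ` (?S0 \<union> ?B1)) (filter (\<lambda>B. B \<noteq> {}) [hyp V ` ?B1])"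
    by (rule inductively_factored_hyp_Un)
       (use V ec in \<open>intro modular_block_differences[of _ ec], auto simp: inner_add_left\<close>)
  then have 2: "inductively_factored_pair V (hyp V ` (?S0 \<union> ?B1 \<union> ?B2))
      (filter (\<lambda>B. B \<noteq> {}) [hyp V ` ?B2, hyp V ` ?B1])"
    by (rule inductively_factored_hyp_Un)
       (use V ey cl in \<open>intro modular_block_differences[of _ ey], auto simp: inner_add_left\<close>)
  then have 3: "inductively_factored_pair V (hyp V ` (?S0 \<union> ?B1 \<union> ?B2 \<union> ?B3))
      (filter (\<lambda>B. B \<noteq> {}) [hyp V ` ?B3, hyp V ` ?B2, hyp V ` ?B1])"
    by (rule inductively_factored_hyp_Un)
       (use V ex cl in \<open>intro modular_block_differences[of _ ex], auto simp: inner_add_left\<close>)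
  then have 4: "inductively_factored_pair V (hyp V ` (?S0 \<union> ?B1 \<union> ?B2 \<union> ?B3 \<union> ?B4))
      (filter (\<lambda>B. B \<noteq> {}) [hyp V ` ?B4, hyp V ` ?B3, hyp V ` ?B2, hyp V ` ?B1])"
    by (rule inductively_factored_hyp_Un)
       (use V ez cl in \<open>intro modular_block_differences[of _ ez], auto simp: inner_add_left\<close>)
  have "?S0 \<union> ?B1 \<union> ?B2 \<union> ?B3 \<union> ?B4 = R" using R by blast
  then show ?thesis using 4 by simp
qed

text \<open>The roots of height at most 3 in type \<open>D\<^sub>4\<close>: once \<open>c + y + z\<close> and then, in the restriction,
  \<open>c + z + x\<close> are split off, all remaining arrangements are built from modular blocks.\<close>

lemma star_factored_full:
  assumes V: "subspace V"
    and co: "\<And>p q r s. \<exists>v\<in>V. c \<bullet> v = p \<and> x \<bullet> v = q \<and> y \<bullet> v = r \<and> z \<bullet> v = s"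
  shows "\<exists>\<pi>. inductively_factored_pair V
    (hyp V ` {c, x, c + x, y, c + y, c + x + y, z, c + z, c + z + x, c + y + z}) \<pi>"
proof -
  define V1 where "V1 = hyp V (c + y + z)"
  define V2 where "V2 = hyp V1 (c + z + x)"
  let ?R9 = "{c, x, c + x, y, c + y, c + x + y, z, c + z, c + z + x}"
  let ?R6 = "{c, z, c + z, x, c + x, c + x + y}"
  obtain ec where ec: "ec \<in> V" "c \<bullet> ec = 1" "x \<bullet> ec = 0" "y \<bullet> ec = 0" "z \<bullet> ec = 0" using co by blast
  obtain ex where ex: "ex \<in> V" "c \<bullet> ex = 0" "x \<bullet> ex = 1" "y \<bullet> ex = 0" "z \<bullet> ex = 0" using co by blast
  obtain ey where ey: "ey \<in> V" "c \<bullet> ey = 0" "x \<bullet> ey = 0" "y \<bullet> ey = 1" "z \<bullet> ey = 0" using co by blast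
  obtain ez where ez: "ez \<in> V" "c \<bullet> ez = 0" "x \<bullet> ez = 0" "y \<bullet> ez = 0" "z \<bullet> ez = 1" using co by blast
  have hV1: "hyperplane_of V V1"
    unfolding V1_def using V ec by (intro hyperplane_of_hyp[of _ ec]) (auto simp: inner_add_left)
  then have sV1: "subspace V1" by (simp add: hyperplane_of_def)
  \<comment> \<open>On \<open>V1\<close> one has \<open>y = - c - z\<close>, leaving
    \<open>c\<close>, \<open>x\<close>, \<open>z\<close> as free coordinates; on \<open>V2\<close>
    also \<open>z = - c - x\<close>, hence \<open>y = x\<close>, leaving \<open>c\<close> and
    \<open>x\<close>.\<close>
  have co1: "\<exists>v\<in>V1. c \<bullet> v = p \<and> x \<bullet> v = q \<and> z \<bullet> v = r \<and> y \<bullet> v = - p - r" for p q r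
    using co[of p q "- p - r" r] by (auto simp: V1_def hyp_def inner_add_left)
  obtain fc where fc: "fc \<in> V1" "c \<bullet> fc = 1" "x \<bullet> fc = 0" "z \<bullet> fc = 0" "y \<bullet> fc = -1" using co1[of 1 0 0] by auto
  obtain fx where fx: "fx \<in> V1" "c \<bullet> fx = 0" "x \<bullet> fx = 1" "z \<bullet> fx = 0" "y \<bullet> fx = 0" using co1[of 0 1 0] by auto
  obtain fz where fz: "fz \<in> V1" "c \<bullet> fz = 0" "x \<bullet> fz = 0" "z \<bullet> fz = 1" "y \<bullet> fz = -1" using co1[of 0 0 1] by auto
  have hV2: "hyperplane_of V1 V2"
    unfolding V2_def using sV1 fc by (intro hyperplane_of_hyp[of _ fc]) (auto simp: inner_add_left)
  then have sV2: "subspace V2" by (simp add: hyperplane_of_def)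
  have co2: "\<exists>v\<in>V2. c \<bullet> v = p \<and> x \<bullet> v = q \<and> z \<bullet> v = - p - q \<and> y \<bullet> v = q" for p q
    using co1[of p q "- p - q"] by (auto simp: V2_def hyp_def inner_add_left)
  obtain gc where gc: "gc \<in> V2" "c \<bullet> gc = 1" "x \<bullet> gc = 0" "z \<bullet> gc = -1" "y \<bullet> gc = 0" using co2[of 1 0] by auto
  obtain gx where gx: "gx \<in> V2" "c \<bullet> gx = 0" "x \<bullet> gx = 1" "z \<bullet> gx = -1" "y \<bullet> gx = 1" using co2[of 0 1] by auto
  have yV1: "y \<bullet> v = - (c \<bullet> v) - z \<bullet> v" if "v \<in> V1" for v
    using that by (auto simp: V1_def hyp_def inner_add_left)
  have zV2: "v \<in> V1 \<and> z \<bullet> v = - (c \<bullet> v) - x \<bullet> v" if "v \<in> V2" for v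
    using that by (auto simp: V2_def hyp_def inner_add_left)
  \<comment> \<open>On \<open>V2\<close> the root \<open>c + x + y\<close> becomes
    \<open>c + 2x\<close>. Any two functionals of the larger block vanish together exactly where
    \<open>c\<close> and \<open>x\<close> both vanish, so \<open>c\<close> always serves as the
    third one.\<close>
  have c2: "inductively_factored_pair V2 (hyp V2 ` ({} \<union> {c} \<union> {x, c + x, c + x + y}))
      (filter (\<lambda>B. B \<noteq> {}) [hyp V2 ` {x, c + x, c + x + y}, hyp V2 ` {c}])"
  proof (intro inductively_factored_hyp_Un)
    show "inductively_factored_pair V2 (hyp V2 ` {}) (filter (\<lambda>B. B \<noteq> {}) [])"
      using inductively_factored_pair.empty[OF sV2] by simp
    show "modular_block V2 (hyp V2 ` {}) (hyp V2 ` {c})"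
      using sV2 gc by (intro modular_block_hyp[of _ gc]) auto
    show "modular_block V2 (hyp V2 ` ({} \<union> {c})) (hyp V2 ` {x, c + x, c + x + y})"
      using sV2 gx zV2 yV1 by (intro modular_block_hyp[of _ gx]) (auto simp: inner_add_left)
  qed
  \<comment> \<open>On \<open>V1\<close> the root \<open>c + x + y\<close> becomes
    \<open>x - z\<close>, and subtracting it from \<open>x\<close> and \<open>c + x\<close> gives
    \<open>z\<close> and \<open>c + z\<close>.\<close>
  have c1: "inductively_factored_pair V1 (hyp V1 ` ({} \<union> {c} \<union> {z, c + z} \<union> {x, c + x, c + x + y}))
      (filter (\<lambda>B. B \<noteq> {}) [hyp V1 ` {x, c + x, c + x + y}, hyp V1 ` {z, c + z}, hyp V1 ` {c}])"
  proof (intro inductively_factored_hyp_Un)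
    show "inductively_factored_pair V1 (hyp V1 ` {}) (filter (\<lambda>B. B \<noteq> {}) [])"
      using inductively_factored_pair.empty[OF sV1] by simp
    show "modular_block V1 (hyp V1 ` {}) (hyp V1 ` {c})"
      using sV1 fc by (intro modular_block_hyp[of _ fc]) auto
    show "modular_block V1 (hyp V1 ` ({} \<union> {c})) (hyp V1 ` {z, c + z})"
      using sV1 fz by (intro modular_block_hyp[of _ fz]) (auto simp: inner_add_left)
    show "modular_block V1 (hyp V1 ` ({} \<union> {c} \<union> {z, c + z})) (hyp V1 ` {x, c + x, c + x + y})"
      using sV1 fx yV1 by (intro modular_block_hyp[of _ fx]) (auto simp: inner_add_left)
  qed
  \<comment> \<open>The kernel \<open>V2\<close> of \<open>c + z + x\<close> joins the block of
    \<open>z\<close>: on \<open>V2\<close> the functionals \<open>z\<close> and \<open>c + z\<close>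
    become \<open>c + x\<close> and \<open>x\<close> up to sign, and these belong to another
    block.\<close>
  have b1: "inductively_factored_pair V1 (insert V2 (hyp V1 ` ?R6))
      (insert V2 (hyp V1 ` {z, c + z}) # [hyp V1 ` {x, c + x, c + x + y}, hyp V1 ` {c}])"
  proof (rule inductively_factored_addition)
    show "inductively_factored_pair V1 (hyp V1 ` ?R6) (filter (\<lambda>B. B \<noteq> {})
        (hyp V1 ` {z, c + z} # [hyp V1 ` {x, c + x, c + x + y}, hyp V1 ` {c}]))"
    proof -
      have eq: "{} \<union> {c} \<union> {z, c + z} \<union> {x, c + x, c + x + y} = ?R6" by blast
      show ?thesis by (rule inductively_factored_pair.renumber[OF c1[unfolded eq]]) simp
    qed
    show "V2 \<notin> hyp V1 ` ?R6"
    proof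
      assume "V2 \<in> hyp V1 ` ?R6"
      then obtain a where a: "a \<in> ?R6" "hyp V1 a = hyp V1 (c + z + x)" unfolding V2_def by blast
      show False
        using a(1) hyp_eq_minor[OF sV1 a(2) fc(1) fx(1)] hyp_eq_minor[OF sV1 a(2) fc(1) fz(1)]
          hyp_eq_minor[OF sV1 a(2) fx(1) fz(1)] fc fx fz by (auto simp: inner_add_left)
    qed
    have un: "\<Union> (set [hyp V1 ` {x, c + x, c + x + y}, hyp V1 ` {c}]) = hyp V1 ` {x, c + x, c + x + y, c}"
      by auto
    show "\<exists>K\<in>\<Union> (set [hyp V1 ` {x, c + x, c + x + y}, hyp V1 ` {c}]). H \<inter> V2 = K \<inter> V2"
      if "H \<in> hyp V1 ` {z, c + z}" for H
    proof -
      have "hyp V1 z \<inter> V2 = hyp V1 (c + x) \<inter> V2" "hyp V1 (c + z) \<inter> V2 = hyp V1 x \<inter> V2"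
        by (auto simp: V2_def hyp_def inner_add_left)
      then show ?thesis using that unfolding un by blast
    qed
    show "inj_on (\<lambda>H. H \<inter> V2) (\<Union> (set [hyp V1 ` {x, c + x, c + x + y}, hyp V1 ` {c}]))"
      unfolding un
    proof (rule inj_on_imageI, rule inj_onI)
      fix a b assume ab: "a \<in> {x, c + x, c + x + y, c}" "b \<in> {x, c + x, c + x + y, c}"
        "((\<lambda>H. H \<inter> V2) \<circ> hyp V1) a = ((\<lambda>H. H \<inter> V2) \<circ> hyp V1) b"
      then have "hyp V2 a = hyp V2 b" by (simp add: V2_def hyp_Int_hyp)
      from hyp_eq_minor[OF sV2 this gc(1) gx(1)] ab(1,2) show "a = b"
        using gc gx by (auto simp: inner_add_left)
    qed
    have "hyp V2 z = hyp V2 (c + x)" "hyp V2 (c + z) = hyp V2 x"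
      by (auto simp: V2_def hyp_def inner_add_left)
    then have "hyp V2 ` ?R6 = hyp V2 ` ({} \<union> {c} \<union> {x, c + x, c + x + y})" by auto
    moreover have "(\<lambda>H. H \<inter> V2) ` hyp V1 ` R = hyp V2 ` R" for R
      unfolding V2_def by (rule image_hyp_Int)
    ultimately show "inductively_factored_pair V2 ((\<lambda>H. H \<inter> V2) ` hyp V1 ` ?R6)
        (map ((`) (\<lambda>H. H \<inter> V2)) [hyp V1 ` {x, c + x, c + x + y}, hyp V1 ` {c}])"
      using c2 by (simp del: Un_insert_right Un_insert_left image_insert)
  qed (use hV2 in auto)
  \<comment> \<open>\<open>V1\<close> joins the block of \<open>y\<close>, whose members become
    \<open>c + z\<close> and \<open>z\<close> on \<open>V1\<close> up to sign. The other seven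
    hyperplanes stay distinct there and form the arrangement factored in \<open>b1\<close>.\<close>
  have b0: "inductively_factored_pair V (insert V1 (hyp V ` ?R9))
      (insert V1 (hyp V ` {y, c + y}) #
        [hyp V ` {z, c + z, c + z + x}, hyp V ` {x, c + x, c + x + y}, hyp V ` {c}])"
  proof (rule inductively_factored_addition)
    let ?Ps = "[hyp V ` {z, c + z, c + z + x}, hyp V ` {x, c + x, c + x + y}, hyp V ` {c}]"
    have "inductively_factored_pair V (hyp V ` ?R9) (filter (\<lambda>B. B \<noteq> {})
      [hyp V ` (?R9 \<inter> {z, c + z, c + z + x}), hyp V ` (?R9 \<inter> {x, c + x, c + x + y}),
       hyp V ` (?R9 \<inter> {y, c + y}), hyp V ` (?R9 \<inter> {c})])"
      using V co by (rule star_factored_missing) simp_all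
    moreover have "?R9 \<inter> {z, c + z, c + z + x} = {z, c + z, c + z + x}"
       "?R9 \<inter> {x, c + x, c + x + y} = {x, c + x, c + x + y}"
       "?R9 \<inter> {y, c + y} = {y, c + y}" "?R9 \<inter> {c} = {c}" by blast+
    ultimately have "inductively_factored_pair V (hyp V ` ?R9) (filter (\<lambda>B. B \<noteq> {})
      [hyp V ` {z, c + z, c + z + x}, hyp V ` {x, c + x, c + x + y},
       hyp V ` {y, c + y}, hyp V ` {c}])" by (simp only:)
    \<comment> \<open>Only the order changes: the block that receives \<open>V1\<close> has to come
      first.\<close>
    then show "inductively_factored_pair V (hyp V ` ?R9) (filter (\<lambda>B. B \<noteq> {}) (hyp V ` {y, c + y} # ?Ps))"
      by (rule inductively_factored_pair.renumber) simp
    show "V1 \<notin> hyp V ` ?R9"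
    proof
      assume "V1 \<in> hyp V ` ?R9"
      then obtain a where a: "a \<in> ?R9" "hyp V a = hyp V (c + y + z)" unfolding V1_def by blast
      show False
        using a(1) hyp_eq_minor[OF V a(2) ec(1) ex(1)] hyp_eq_minor[OF V a(2) ec(1) ey(1)]
          hyp_eq_minor[OF V a(2) ey(1) ez(1)] ec ex ey ez by (auto simp: inner_add_left)
    qed
    let ?R7 = "{z, c + z, c + z + x, x, c + x, c + x + y, c}"
    have un: "\<Union> (set ?Ps) = hyp V ` ?R7" by auto
    show "\<exists>K\<in>\<Union> (set ?Ps). H \<inter> V1 = K \<inter> V1" if "H \<in> hyp V ` {y, c + y}" for H
    proof -
      have "hyp V y \<inter> V1 = hyp V (c + z) \<inter> V1" "hyp V (c + y) \<inter> V1 = hyp V z \<inter> V1"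
        by (auto simp: V1_def hyp_def inner_add_left)
      then show ?thesis using that unfolding un by blast
    qed
    show "inj_on (\<lambda>H. H \<inter> V1) (\<Union> (set ?Ps))"
      unfolding un
    proof (rule inj_on_imageI, rule inj_onI)
      fix a b assume ab: "a \<in> ?R7" "b \<in> ?R7"
        "((\<lambda>H. H \<inter> V1) \<circ> hyp V) a = ((\<lambda>H. H \<inter> V1) \<circ> hyp V) b"
      then have h: "hyp V1 a = hyp V1 b" by (simp add: V1_def hyp_Int_hyp)
      from hyp_eq_minor[OF sV1 h fc(1) fx(1)] hyp_eq_minor[OF sV1 h fc(1) fz(1)]
        hyp_eq_minor[OF sV1 h fx(1) fz(1)] ab(1,2) show "a = b"
        using fc fx fz by (auto simp: inner_add_left)
    qed
    have "hyp V1 y = hyp V1 (c + z)" "hyp V1 (c + y) = hyp V1 z"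
      by (auto simp: V1_def hyp_def inner_add_left)
    then have "hyp V1 ` ?R9 = insert V2 (hyp V1 ` ?R6)" by (auto simp: V2_def)
    moreover have "(\<lambda>H. H \<inter> V1) ` hyp V ` R = hyp V1 ` R" for R
      unfolding V1_def by (rule image_hyp_Int)
    moreover have "hyp V1 ` {z, c + z, c + z + x} = insert V2 (hyp V1 ` {z, c + z})"
      by (auto simp: V2_def)
    ultimately show "inductively_factored_pair V1 ((\<lambda>H. H \<inter> V1) ` hyp V ` ?R9)
        (map ((`) (\<lambda>H. H \<inter> V1)) ?Ps)"
      using b1 by (simp del: image_insert)
  qed (use hV1 in auto)
  have "insert V1 (hyp V ` ?R9) = hyp V ` {c, x, c + x, y, c + y, c + x + y, z, c + z, c + z + x, c + y + z}"
    by (auto simp: V1_def)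
  then show ?thesis using b0 by (intro exI) simp
qed

text \<open>Rotating \<open>x\<close>, \<open>y\<close>, \<open>z\<close> permutes the three roots
  of height 3 cyclically, so a missing one can be moved to the place of \<open>c + y + z\<close>. If
  none is missing, closure fills up \<open>R\<close>.\<close>

lemma star_factored:
  assumes V: "subspace V"
    and co: "\<And>p q r s. \<exists>v\<in>V. c \<bullet> v = p \<and> x \<bullet> v = q \<and> y \<bullet> v = r \<and> z \<bullet> v = s"
    and R: "R \<subseteq> {c, x, c + x, y, c + y, c + x + y, z, c + z, c + z + x, c + y + z}"
    and cl: "c + x \<in> R \<Longrightarrow> c \<in> R \<and> x \<in> R" "c + y \<in> R \<Longrightarrow> c \<in> R \<and> y \<in> R"
      "c + z \<in> R \<Longrightarrow> c \<in> R \<and> z \<in> R" "c + x + y \<in> R \<Longrightarrow> c + x \<in> R \<and> c + y \<in> R"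
      "c + z + x \<in> R \<Longrightarrow> c + z \<in> R \<and> c + x \<in> R" "c + y + z \<in> R \<Longrightarrow> c + y \<in> R \<and> c + z \<in> R"
  shows "\<exists>\<pi>. inductively_factored_pair V (hyp V ` R) \<pi>"
proof -
  consider "c + y + z \<notin> R" | "c + z + x \<notin> R" | "c + x + y \<notin> R"
    | "c + x + y \<in> R" "c + z + x \<in> R" "c + y + z \<in> R" by blast
  then show ?thesis
  proof cases
    case 1
    show ?thesis
      by (rule exI, rule star_factored_missing[OF V co]) (use R 1 cl in auto)
  next
    case 2
    have co': "\<exists>v\<in>V. c \<bullet> v = p \<and> y \<bullet> v = q \<and> z \<bullet> v = r \<and> x \<bullet> v = s" for p q r s
      using co[of p s q r] by blast
    show ?thesis
      by (rule exI, rule star_factored_missing[OF V co']) (use R 2 cl in \<open>auto simp: add.assoc add.commute\<close>)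
  next
    case 3
    have co': "\<exists>v\<in>V. c \<bullet> v = p \<and> z \<bullet> v = q \<and> x \<bullet> v = r \<and> y \<bullet> v = s" for p q r s
      using co[of p r s q] by blast
    show ?thesis
      by (rule exI, rule star_factored_missing[OF V co']) (use R 3 cl in \<open>auto simp: add.assoc add.commute\<close>)
  next
    case 4
    then have "R = {c, x, c + x, y, c + y, c + x + y, z, c + z, c + z + x, c + y + z}"
      using R cl by blast
    then show ?thesis using star_factored_full[OF V co] by simp
  qed
qed

section \<open>Roots of small height\<close>

text \<open>Vertex \<open>0\<close> is the branch vertex, \<open>1\<close>, \<open>2\<close>, \<open>3\<close> are its neighbours, and \<open>par k\<close> is the
  neighbour of \<open>k\<close> towards \<open>0\<close>; injectivity of \<open>par\<close> says that the arms are paths. The value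
  \<open>par 0\<close> is irrelevant.\<close>

locale labelled_tree =
  fixes \<Phi> \<Delta> :: "'a::euclidean_space set" and b :: "nat \<Rightarrow> 'a" and par :: "nat \<Rightarrow> nat" and n :: nat
  assumes root_system: "root_system \<Phi>" and simple_roots: "simple_roots \<Phi> \<Delta>"
    and bij: "bij_betw b {..<n} \<Delta>" and n4: "4 \<le> n"
    and cartan: "\<And>j k. j < k \<Longrightarrow> k < n \<Longrightarrow>
      cartan_int (b j) (b k) = (if j = par k then - 1 else 0) \<and>
      cartan_int (b k) (b j) = (if j = par k then - 1 else 0)"
    and par_less: "\<And>k. 0 < k \<Longrightarrow> k < n \<Longrightarrow> par k < k"
    and par_small: "\<And>k. 0 < k \<Longrightarrow> k < 4 \<Longrightarrow> par k = 0"
    and par_pos: "\<And>k. 4 \<le> k \<Longrightarrow> k < n \<Longrightarrow> 0 < par k"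
    and par_inj: "inj_on par {4..<n}"
begin

abbreviation co :: "'a \<Rightarrow> nat \<Rightarrow> real" where
  "co \<alpha> k \<equiv> representation \<Delta> \<alpha> (b k)"

definition adj :: "nat \<Rightarrow> nat \<Rightarrow> bool" where
  "adj j k \<longleftrightarrow> (j < k \<and> j = par k) \<or> (k < j \<and> k = par j)"

lemma indep: "independent \<Delta>" and Delta_sub: "\<Delta> \<subseteq> \<Phi>" and fin_Delta: "finite \<Delta>"
  and Phi_span: "\<Phi> \<subseteq> span \<Delta>"
  using simple_roots independent_imp_finite by (auto simp: simple_roots_def)

lemma b_Delta: "k < n \<Longrightarrow> b k \<in> \<Delta>"
  using bij by (auto simp: bij_betw_def)

lemma b_inj: "j < n \<Longrightarrow> k < n \<Longrightarrow> b j = b k \<longleftrightarrow> j = k"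
  using bij by (auto simp: bij_betw_def dest: inj_onD)

lemma b_Phi: "k < n \<Longrightarrow> b k \<in> \<Phi>"
  using b_Delta Delta_sub by blast

lemma ball_Delta: "(\<forall>\<beta>\<in>\<Delta>. P \<beta>) \<longleftrightarrow> (\<forall>k<n. P (b k))"
  using bij by (force simp: bij_betw_def)

lemma co_b: "j < n \<Longrightarrow> k < n \<Longrightarrow> co (b j) k = (if j = k then 1 else 0)"
  using representation_basis[OF indep b_Delta] b_inj by auto

lemma co_add: "\<alpha> \<in> span \<Delta> \<Longrightarrow> \<beta> \<in> span \<Delta> \<Longrightarrow> co (\<alpha> + \<beta>) k = co \<alpha> k + co \<beta> k"
  by (simp add: representation_add[OF indep])

lemma co_diff: "\<alpha> \<in> span \<Delta> \<Longrightarrow> \<beta> \<in> span \<Delta> \<Longrightarrow> co (\<alpha> - \<beta>) k = co \<alpha> k - co \<beta> k"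
  by (simp add: representation_diff[OF indep])

lemma co_scale: "\<alpha> \<in> span \<Delta> \<Longrightarrow> co (r *\<^sub>R \<alpha>) k = r * co \<alpha> k"
  by (simp add: representation_scale[OF indep])

lemma expand: "\<alpha> \<in> span \<Delta> \<Longrightarrow> \<alpha> = (\<Sum>k<n. co \<alpha> k *\<^sub>R b k)"
  using sum_representation_eq[OF indep _ fin_Delta order_refl, of \<alpha>]
    sum.reindex_bij_betw[OF bij, of "\<lambda>\<beta>. representation \<Delta> \<alpha> \<beta> *\<^sub>R \<beta>"] by simp

lemma ht_co: "ht \<Delta> \<alpha> = (\<Sum>k<n. co \<alpha> k)"
  unfolding ht_def using sum.reindex_bij_betw[OF bij, of "representation \<Delta> \<alpha>"] by simp

lemma positive_iff: "\<alpha> \<in> positive_roots \<Phi> \<Delta> \<longleftrightarrow> \<alpha> \<in> \<Phi> \<and> (\<forall>k<n. 0 \<le> co \<alpha> k)"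
  by (simp add: positive_roots_def ball_Delta)

lemma signs: "\<alpha> \<in> \<Phi> \<Longrightarrow> (\<forall>k<n. 0 \<le> co \<alpha> k) \<or> (\<forall>k<n. co \<alpha> k \<le> 0)"
  using simple_roots unfolding simple_roots_def ball_Delta by blast

lemma co_Ints: "\<alpha> \<in> \<Phi> \<Longrightarrow> k < n \<Longrightarrow> co \<alpha> k \<in> \<int>"
  using simple_roots unfolding simple_roots_def ball_Delta by blast

lemma b_positive: "k < n \<Longrightarrow> b k \<in> positive_roots \<Phi> \<Delta>"
  by (simp add: positive_iff b_Phi co_b)

lemma cartan_b: "j < n \<Longrightarrow> k < n \<Longrightarrow>
    cartan_int (b j) (b k) = (if j = k then 2 else if adj j k then - 1 else 0)"
proof -
  assume jk: "j < n" "k < n"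
  have "b k \<noteq> 0" using b_Phi[OF jk(2)] root_system by (auto simp: root_system_def)
  then have "cartan_int (b k) (b k) = 2" by (simp add: cartan_int_def)
  then show ?thesis
    using cartan[of j k] cartan[of k j] jk by (cases j k rule: linorder_cases) (auto simp: adj_def)
qed

text \<open>Linearity in the first argument reduces this to entries of the Cartan matrix.\<close>

lemma cartan_sum:
  assumes "\<alpha> \<in> \<Phi>" "i < n"
  shows "cartan_int \<alpha> (b i) = 2 * co \<alpha> i - (\<Sum>j\<in>{j. j < n \<and> adj j i}. co \<alpha> j)"
proof -
  have lin: "cartan_int (\<Sum>k<n. f k *\<^sub>R b k) \<beta> = (\<Sum>k<n. f k * cartan_int (b k) \<beta>)" for f \<beta>
    by (simp add: cartan_int_def inner_sum_left sum_distrib_left sum_divide_distrib mult.left_commute)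
  have "cartan_int \<alpha> (b i) = (\<Sum>k<n. co \<alpha> k * cartan_int (b k) (b i))"
    using expand[of \<alpha>] lin[of "co \<alpha>"] Phi_span assms by (metis subsetD)
  also have "\<dots> = (\<Sum>k<n. (if k = i then 2 * co \<alpha> k else 0) - (if adj k i then co \<alpha> k else 0))"
    using assms by (intro sum.cong) (auto simp: cartan_b, auto simp: adj_def)
  also have "\<dots> = 2 * co \<alpha> i - (\<Sum>k<n. if adj k i then co \<alpha> k else 0)"
    using assms by (simp add: sum_subtractf)
  also have "(\<Sum>k<n. if adj k i then co \<alpha> k else 0) = (\<Sum>j\<in>{j. j < n \<and> adj j i}. co \<alpha> j)"
    by (rule sum.mono_neutral_cong_right) auto
  finally show ?thesis .
qed

lemma reflect: "\<alpha> \<in> \<Phi> \<Longrightarrow> i < n \<Longrightarrow> \<alpha> - cartan_int \<alpha> (b i) *\<^sub>R b i \<in> \<Phi>"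
  using root_system b_Phi unfolding root_system_def by blast

text \<open>Otherwise the reflection in \<open>b i\<close> would produce a root with coefficients of both signs.\<close>

lemma co_le_neighbours:
  assumes "\<alpha> \<in> \<Phi>" "i < n" "k < n" "i \<noteq> k" "0 < co \<alpha> k"
  shows "co \<alpha> i \<le> (\<Sum>j\<in>{j. j < n \<and> adj j i}. co \<alpha> j)"
proof -
  let ?\<beta> = "\<alpha> - cartan_int \<alpha> (b i) *\<^sub>R b i"
  have sp: "\<alpha> \<in> span \<Delta>" "b i \<in> span \<Delta>" using assms Phi_span b_Phi by blast+
  have c: "co ?\<beta> j = co \<alpha> j - cartan_int \<alpha> (b i) * (if i = j then 1 else 0)" if "j < n" for j
    using sp that assms by (simp add: co_diff co_scale span_scale co_b)
  have "0 < co ?\<beta> k" using c assms by simp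
  then have "0 \<le> co ?\<beta> i" using signs[OF reflect[OF assms(1,2)]] assms by force
  then show ?thesis using c assms cartan_sum[OF assms(1,2)] by simp
qed

lemma edge_positive:
  assumes "0 < k" "k < n" shows "b k + b (par k) \<in> positive_roots \<Phi> \<Delta>"
proof -
  have p: "par k < k" using par_less assms by blast
  then have "cartan_int (b k) (b (par k)) = - 1" using cartan assms by simp
  then have "b k + b (par k) \<in> \<Phi>" using reflect[of "b k" "par k"] assms p b_Phi by simp
  moreover have "b k \<in> span \<Delta>" "b (par k) \<in> span \<Delta>"
    using assms p by (auto intro!: span_base b_Delta)
  ultimately show ?thesis using assms p by (simp add: positive_iff co_add co_b)
qed

text \<open>The coefficients are nonnegative integers of sum at most 3, each bounded by the sum over
  its neighbours unless the support is one vertex; only paths survive. The third case records its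
  height so that a bound below 3 excludes it.\<close>

lemma low_roots:
  assumes \<alpha>: "\<alpha> \<in> positive_roots \<Phi> \<Delta>" and ht: "ht \<Delta> \<alpha> < 4"
  shows "(\<exists>k<n. \<alpha> = b k) \<or> (\<exists>k<n. 0 < k \<and> \<alpha> = b k + b (par k)) \<or>
    (ht \<Delta> \<alpha> = 3 \<and> ((\<exists>k<n. 4 \<le> k \<and> \<alpha> = b k + b (par k) + b (par (par k))) \<or>
      (\<exists>i j. 0 < i \<and> i < j \<and> j < 4 \<and> \<alpha> = b 0 + b i + b j)))"
proof -
  have a: "\<alpha> \<in> \<Phi>" "\<And>k. k < n \<Longrightarrow> 0 \<le> co \<alpha> k" using \<alpha> by (auto simp: positive_iff)
  define f where "f k = nat \<lfloor>co \<alpha> k\<rfloor>" for k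
  have f: "co \<alpha> k = real (f k)" if "k < n" for k
    using a(2)[OF that] co_Ints[OF a(1) that] by (auto simp: f_def Ints_def)
  define S where "S = {k. k < n \<and> 0 < f k}"
  have finS: "finite S" by (simp add: S_def)
  have Sn: "k < n" "0 < f k" if "k \<in> S" for k using that by (auto simp: S_def)
  have htf: "ht \<Delta> \<alpha> = real (\<Sum>k\<in>S. f k)"
    unfolding ht_co of_nat_sum using f by (intro sum.mono_neutral_cong_right) (auto simp: S_def)
  then have sum3: "(\<Sum>k\<in>S. f k) \<le> 3" using ht by linarith
  have af: "\<alpha> = (\<Sum>k\<in>S. real (f k) *\<^sub>R b k)"
  proof -
    have "\<alpha> = (\<Sum>k<n. co \<alpha> k *\<^sub>R b k)" using expand a(1) Phi_span by blast
    also have "\<dots> = (\<Sum>k\<in>S. real (f k) *\<^sub>R b k)"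
      using f by (intro sum.mono_neutral_cong_right) (auto simp: S_def)
    finally show ?thesis .
  qed
  have nb: "f i \<le> (\<Sum>j\<in>{j \<in> S. adj j i}. f j)" if "i \<in> S" "k \<in> S" "i \<noteq> k" for i k
  proof -
    have "co \<alpha> i \<le> (\<Sum>j\<in>{j. j < n \<and> adj j i}. co \<alpha> j)"
      using Sn that f by (intro co_le_neighbours[of _ _ k] a) auto
    also have "\<dots> = real (\<Sum>j\<in>{j \<in> S. adj j i}. f j)"
      unfolding of_nat_sum using f by (intro sum.mono_neutral_cong_right) (auto simp: S_def)
    finally show ?thesis unfolding f[OF Sn(1)[OF that(1)]] of_nat_le_iff .
  qed
  have "card S \<le> (\<Sum>k\<in>S. f k)"
    using sum_mono[of S "\<lambda>_. 1" f] Sn by (simp add: Suc_leI)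
  with sum3 have "card S \<le> 3" by linarith
  moreover have "S \<noteq> {}" using af a(1) root_system by (auto simp: root_system_def)
  then have "card S \<noteq> 0" using finS by simp
  ultimately consider "card S = 1" | "card S = 2" | "card S = 3" by linarith
  then show ?thesis
  proof cases
    case 1
    then obtain k where S: "S = {k}" by (auto simp: card_1_singleton_iff)
    then have "\<alpha> = real (f k) *\<^sub>R b k" using af by simp
    moreover have "k < n" "0 < f k" using Sn S by auto
    \<comment> \<open>Reducedness excludes larger multiples of a simple root.\<close>
    moreover have "real (f k) = 1"
      using calculation root_system a(1) b_Phi[of k] unfolding root_system_def by fastforce
    ultimately show ?thesis by auto
  next
    case 2
    then obtain i j where ij: "S = {i, j}" "i < j"
      by (metis card_2_iff doubleton_eq_iff linorder_neqE_nat)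
    \<comment> \<open>The two bounds force the vertices to be adjacent with equal coefficients; a
      sum of at most 3 then makes both equal to 1.\<close>
    have le: "f i \<le> (if adj j i then f j else 0)" "f j \<le> (if adj i j then f i else 0)"
    proof -
      have "{l \<in> S. adj l i} = (if adj j i then {j} else {})" "{l \<in> S. adj l j} = (if adj i j then {i} else {})"
        using ij by (auto simp: adj_def)
      then show "f i \<le> (if adj j i then f j else 0)" "f j \<le> (if adj i j then f i else 0)"
        using nb[of i j] nb[of j i] ij by (auto split: if_splits)
    qed
    have ne: "0 < f i" "0 < f j" "j < n" using Sn ij by auto
    have "adj i j" using le ne by (auto split: if_splits)
    then have p: "i = par j" using ij by (auto simp: adj_def)
    have "f i = f j" using le ne by (auto split: if_splits)
    moreover have "f i + f j \<le> 3" using sum3 ij by simp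
    ultimately have "f i = 1" "f j = 1" using ne by linarith+
    then have "\<alpha> = b j + b (par j)" using af ij p by (simp add: add.commute)
    then show ?thesis using ne ij by auto
  next
    case 3
    then obtain u v w where uvw: "S = {u, v, w}" "u \<noteq> v" "u \<noteq> w" "v \<noteq> w" by (auto simp: card_3_iff)
    obtain i j k where ijk: "S = {i, j, k}" "i < j" "j < k"
    proof -
      consider "u < v \<and> v < w" | "u < w \<and> w < v" | "v < u \<and> u < w" | "v < w \<and> w < u"
        | "w < u \<and> u < v" | "w < v \<and> v < u" using uvw(2-4) by linarith
      then show thesis
      proof cases
        case 1 then show thesis using uvw(1) by (intro that[of u v w]) blast+
      next
        case 2 then show thesis using uvw(1) by (intro that[of u w v]) blast+
      next
        case 3 then show thesis using uvw(1) by (intro that[of v u w]) blast+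
      next
        case 4 then show thesis using uvw(1) by (intro that[of v w u]) blast+
      next
        case 5 then show thesis using uvw(1) by (intro that[of w u v]) blast+
      next
        case 6 then show thesis using uvw(1) by (intro that[of w v u]) blast+
      qed
    qed
    have ne: "0 < f i" "0 < f j" "0 < f k" "i < n" "j < n" "k < n" using Sn ijk by auto
    have "f i + f j + f k \<le> 3" using sum3 ijk by (simp add: add.assoc)
    then have f1: "f i = 1" "f j = 1" "f k = 1" using ne by linarith+
    have ht3: "ht \<Delta> \<alpha> = 3" using htf ijk f1 by simp
    have al: "\<alpha> = b i + b j + b k" using af ijk f1 by (simp add: add.assoc)
    \<comment> \<open>A vertex of the support with no neighbour in it would have coefficient
      0.\<close>
    have ex: "\<exists>m\<in>S. adj m l" if l: "l \<in> S" for l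
    proof (rule ccontr)
      assume "\<not> (\<exists>m\<in>S. adj m l)"
      then have e: "{m \<in> S. adj m l} = {}" by blast
      have "\<exists>m\<in>S. l \<noteq> m" using ijk l by auto
      then obtain m where "m \<in> S" "l \<noteq> m" by blast
      then show False using nb[OF l] e Sn[OF l] by fastforce
    qed
    \<comment> \<open>Every edge joins a vertex to its smaller \<open>par\<close>, so these
      alternatives express that the support is connected.\<close>
    have pk: "par k = i \<or> par k = j" using ex[of k] ijk by (auto simp: adj_def)
    have pi: "par j = i \<or> par k = i" using ex[of i] ijk by (auto simp: adj_def)
    have pj: "par j = i \<or> par k = j" using ex[of j] ijk by (auto simp: adj_def)
    show ?thesis
    proof (cases "par k = j")
      case True
      then have "par j = i" using pi ijk by auto
      moreover have "4 \<le> k" using True par_small[of k] ijk by (cases "k < 4") auto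
      ultimately show ?thesis using True al ne ht3 by (auto simp: ac_simps)
    next
      case False
      \<comment> \<open>Both \<open>j\<close> and \<open>k\<close> hang on \<open>i\<close>; away
        from 0 a vertex has at most one child, so \<open>i\<close> must be the branch
        vertex.\<close>
      then have p: "par k = i" "par j = i" using pk pj by auto
      have "k < 4"
      proof (rule ccontr)
        assume "\<not> k < 4"
        then have "0 < i" using par_pos[of k] p ne by auto
        then have "4 \<le> j" using par_small[of j] p ijk by (cases "j < 4") auto
        then have "j = k" using par_inj p ne \<open>\<not> k < 4\<close> by (auto simp: inj_on_def)
        then show False using ijk by simp
      qed
      then have "i = 0" using par_small[of k] p ijk by simp
      then show ?thesis using al ht3 ijk \<open>k < 4\<close> by auto
    qed
  qed
qed

text \<open>A functional with the prescribed values is the inner product with a vector, which is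
  then projected to \<open>span \<Phi>\<close> because the roots need not span the ambient type. A
  Kronecker delta \<open>g\<close> gives a fundamental coweight.\<close>

lemma dual_vectors: "\<exists>v\<in>span \<Phi>. \<forall>k<n. b k \<bullet> v = g k"
proof -
  obtain h :: "'a \<Rightarrow> real" where h: "linear h" "\<And>x. x \<in> \<Delta> \<Longrightarrow> h x = g (inv_into {..<n} b x)"
    using linear_independent_extend[OF indep, of "\<lambda>x. g (inv_into {..<n} b x)"] by blast
  obtain y z where yz: "y \<in> span \<Phi>" "\<And>w. w \<in> span \<Phi> \<Longrightarrow> orthogonal z w" "adjoint h 1 = y + z"
    using orthogonal_subspace_decomp_exists[of \<Phi> "adjoint h 1"] by metis
  have "b k \<bullet> y = g k" if "k < n" for k
  proof -
    have "b k \<bullet> z = 0"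
      using yz(2)[of "b k"] b_Phi[OF that] by (simp add: orthogonal_def span_base inner_commute)
    then have "b k \<bullet> y = b k \<bullet> adjoint h 1" by (simp add: yz(3) inner_add_right)
    also have "\<dots> = h (b k)" using adjoint_works[OF h(1), of "b k" 1] by simp
    also have "\<dots> = g k"
      using h(2)[OF b_Delta[OF that]] bij that by (simp add: bij_betw_def)
    finally show ?thesis .
  qed
  then show ?thesis using yz(1) by blast
qed

section \<open>Arrangements of complements of ideals\<close>

context
  fixes I R
  assumes ideal: "root_ideal \<Phi> \<Delta> I"
  defines "R \<equiv> positive_roots \<Phi> \<Delta> - I"
begin

lemma arrangement_hyp: "ideal_arrangement \<Phi> \<Delta> I = hyp (span \<Phi>) ` R"
  by (auto simp: ideal_arrangement_def R_def root_hyperplane_def hyp_def)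

lemma finite_R: "finite R"
  using root_system by (auto simp: R_def positive_roots_def root_system_def)

text \<open>The ideal enters only here: differences within a block are summands of its larger root,
  so they stay in the complement.\<close>

lemma complement_closed:
  "\<alpha> \<in> positive_roots \<Phi> \<Delta> \<Longrightarrow> \<beta> \<in> positive_roots \<Phi> \<Delta> \<Longrightarrow> \<alpha> + \<beta> \<in> R \<Longrightarrow> \<alpha> \<in> R"
  using ideal unfolding root_ideal_def R_def by blast

lemma edge_closed:
  assumes "b k + b (par k) \<in> R" "0 < k" "k < n" shows "b k \<in> R" "b (par k) \<in> R"
proof -
  have p: "par k < n" using par_less[of k] assms by linarith
  show "b k \<in> R" using complement_closed[of "b k" "b (par k)"] assms p b_positive by blast
  show "b (par k) \<in> R"
    using complement_closed[of "b (par k)" "b k"] assms p b_positive by (simp add: add.commute)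
qed

lemma path_closed:
  assumes "b k + b (par k) + b (par (par k)) \<in> R" "0 < par k" "0 < k" "k < n"
  shows "b k + b (par k) \<in> R" "b (par k) + b (par (par k)) \<in> R"
proof -
  have p: "par k < k" "par (par k) < par k" using par_less[of k] par_less[of "par k"] assms by auto
  then show "b k + b (par k) \<in> R"
    using complement_closed[of "b k + b (par k)" "b (par (par k))"] assms edge_positive[of k] b_positive
    by auto
  show "b (par k) + b (par (par k)) \<in> R"
    using complement_closed[of "b (par k) + b (par (par k))" "b k"] assms edge_positive[of "par k"] b_positive p
    by (simp add: ac_simps)
qed

lemma supersolvable_ideal:
  assumes "height_ideal \<Phi> \<Delta> 3 \<subseteq> I"
  shows "supersolvable (span \<Phi>) (ideal_arrangement \<Phi> \<Delta> I)"
proof -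
  \<comment> \<open>Vertex 0 is separate because \<open>par 0\<close> carries no meaning.\<close>
  define B where "B k = R \<inter> (if k = 0 then {b 0} else {b k, b k + b (par k)})" for k
  let ?V = "span \<Phi>"
  have B_b: "b k \<in> B k" if "b k \<in> R" for k using that by (auto simp: B_def)
  have step: "modular_block ?V (hyp ?V ` (\<Union>k<m. B k)) (hyp ?V ` B m)" if m: "m < n" for m
  proof -
    \<comment> \<open>The fundamental coweight of \<open>m\<close>: earlier blocks involve only
      smaller vertices, while each root of block \<open>m\<close> has coefficient 1 at
      \<open>m\<close>.\<close>
    obtain u where u: "u \<in> ?V" "\<And>k. k < n \<Longrightarrow> b k \<bullet> u = (if k = m then 1 else 0)"
      using dual_vectors[of "\<lambda>k. if k = m then 1 else 0"] by blast
    show ?thesis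
    proof (rule modular_block_differences[of _ u])
      show "finite (B m)" using finite_R by (simp add: B_def)
    next
      fix a assume "a \<in> (\<Union>k<m. B k)"
      then obtain k where k: "k < m" "a \<in> B k" by blast
      then show "a \<bullet> u = 0"
        using m par_less[of k] u by (auto simp: B_def inner_add_left split: if_splits)
    next
      fix a assume "a \<in> B m"
      then show "a \<bullet> u \<noteq> 0"
        using m par_less[of m] u by (auto simp: B_def inner_add_left split: if_splits)
    next
      fix a a' assume aa: "a \<in> B m" "a' \<in> B m" "a \<noteq> a'"
      then have "0 < m" "b m + b (par m) \<in> R" and d: "a - a' = b (par m) \<or> a' - a = b (par m)"
        by (auto simp: B_def split: if_splits)
      then have "b (par m) \<in> (\<Union>k<m. B k)"
        using m edge_closed B_b par_less by blast
      then show "a - a' \<in> (\<Union>k<m. B k) \<or> a' - a \<in> (\<Union>k<m. B k)" using d by auto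
    qed (use u in auto)
  qed
  have "supersolvable ?V (hyp ?V ` (\<Union>k<m. B k)) \<and> central_arrangement ?V (hyp ?V ` (\<Union>k<m. B k))"
    if "m \<le> n" for m
    using that
  proof (induction m)
    case 0
    then show ?case using supersolvable_empty[of ?V] by (simp add: central_arrangement_def)
  next
    case (Suc m)
    have "hyp ?V ` (\<Union>k<Suc m. B k) = hyp ?V ` (\<Union>k<m. B k) \<union> hyp ?V ` B m"
      by (simp add: lessThan_Suc image_Un Un_commute)
    moreover have "modular_block ?V (hyp ?V ` (\<Union>k<m. B k)) (hyp ?V ` B m)"
      using step[of m] Suc.prems by simp
    ultimately show ?case
      using Suc.IH Suc.prems supersolvable_Un_block central_arrangement_Un_block
      by (metis Suc_leD)
  qed
  then have "supersolvable ?V (hyp ?V ` (\<Union>k<n. B k))" by blast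
  moreover have "(\<Union>k<n. B k) = R"
  proof
    show "R \<subseteq> (\<Union>k<n. B k)"
    proof
      fix \<alpha> assume \<alpha>: "\<alpha> \<in> R"
      then have "\<alpha> \<in> positive_roots \<Phi> \<Delta>" "ht \<Delta> \<alpha> < 3"
        using assms by (auto simp: R_def height_ideal_def not_le[symmetric])
      then have "(\<exists>k<n. \<alpha> = b k) \<or> (\<exists>k<n. 0 < k \<and> \<alpha> = b k + b (par k))"
        using low_roots[of \<alpha>] by auto
      then show "\<alpha> \<in> (\<Union>k<n. B k)" using \<alpha> by (auto simp: B_def)
    qed
  qed (auto simp: B_def)
  ultimately show ?thesis by (simp add: arrangement_hyp)
qed

lemma inductively_factored_ideal:
  assumes "height_ideal \<Phi> \<Delta> 4 \<subseteq> I"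
  shows "inductively_factored (span \<Phi>) (ideal_arrangement \<Phi> \<Delta> I)"
proof -
  let ?V = "span \<Phi>"
  \<comment> \<open>The part on the branch vertex and its neighbours, in the cyclic pattern of
    \<open>star_factored\<close>.\<close>
  define S where "S = R \<inter> {b 0, b 1, b 0 + b 1, b 2, b 0 + b 2, b 0 + b 1 + b 2,
    b 3, b 0 + b 3, b 0 + b 3 + b 1, b 0 + b 2 + b 3}"
  define B where "B k = R \<inter> {b k, b k + b (par k), b k + b (par k) + b (par (par k))}" for k
  define T where "T m = S \<union> (\<Union>k\<in>{4..<m}. B k)" for m
  have small: "k = 0 \<or> k = 1 \<or> k = 2 \<or> k = 3" if "k < 4" for k :: nat using that by linarith
  have T_b: "b k \<in> T m" if "b k \<in> R" "k < m" for k m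
    using that small[of k] by (cases "k < 4") (auto simp: T_def S_def B_def)
  have T_edge: "b k + b (par k) \<in> T m" if "b k + b (par k) \<in> R" "0 < k" "k < m" for k m
    using that small[of k] par_small[of k]
    by (cases "k < 4") (auto simp: T_def S_def B_def add.commute)
  have small_edge: "b 0 \<in> R \<and> b k \<in> R" if "b 0 + b k \<in> R" "0 < k" "k < 4" for k
    using edge_closed[of k] par_small[of k] that n4 by (simp add: add.commute)
  have small_path: "b 0 + b j \<in> R \<and> b 0 + b k \<in> R"
    if "b 0 + b j + b k \<in> R" "0 < j" "j < 4" "0 < k" "k < 4" for j k
    using complement_closed[of "b j + b 0" "b k"] complement_closed[of "b k + b 0" "b j"]
      edge_positive[of j] edge_positive[of k] par_small[of j] par_small[of k] b_positive[of j] b_positive[of k]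
      that n4 by (simp add: ac_simps)
  have base: "\<exists>\<pi>. inductively_factored_pair ?V (hyp ?V ` S) \<pi>"
  proof (rule star_factored[where c = "b 0" and x = "b 1" and y = "b 2" and z = "b 3"])
    fix p q r s
    show "\<exists>v\<in>?V. b 0 \<bullet> v = p \<and> b 1 \<bullet> v = q \<and> b 2 \<bullet> v = r \<and> b 3 \<bullet> v = s"
      using dual_vectors[of "\<lambda>k. if k = 0 then p else if k = 1 then q else if k = 2 then r else s"] n4
      by fastforce
    show "S \<subseteq> {b 0, b 1, b 0 + b 1, b 2, b 0 + b 2, b 0 + b 1 + b 2, b 3, b 0 + b 3, b 0 + b 3 + b 1, b 0 + b 2 + b 3}"
      unfolding S_def by (rule Int_lower2)
    show "b 0 + b 1 \<in> S \<Longrightarrow> b 0 \<in> S \<and> b 1 \<in> S" "b 0 + b 2 \<in> S \<Longrightarrow> b 0 \<in> S \<and> b 2 \<in> S"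
      "b 0 + b 3 \<in> S \<Longrightarrow> b 0 \<in> S \<and> b 3 \<in> S"
      using small_edge[of 1] small_edge[of 2] small_edge[of 3] unfolding S_def by simp_all
    show "b 0 + b 1 + b 2 \<in> S \<Longrightarrow> b 0 + b 1 \<in> S \<and> b 0 + b 2 \<in> S"
      "b 0 + b 3 + b 1 \<in> S \<Longrightarrow> b 0 + b 3 \<in> S \<and> b 0 + b 1 \<in> S"
      "b 0 + b 2 + b 3 \<in> S \<Longrightarrow> b 0 + b 2 \<in> S \<and> b 0 + b 3 \<in> S"
      using small_path[of 1 2] small_path[of 3 1] small_path[of 2 3] unfolding S_def by simp_all
  qed simp
  have step: "modular_block ?V (hyp ?V ` T m) (hyp ?V ` B m)" if m: "4 \<le> m" "m < n" for m
  proof -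
    obtain u where u: "u \<in> ?V" "\<And>k. k < n \<Longrightarrow> b k \<bullet> u = (if k = m then 1 else 0)"
      using dual_vectors[of "\<lambda>k. if k = m then 1 else 0"] by blast
    \<comment> \<open>Positivity of \<open>par k\<close> keeps \<open>par (par k)\<close> from being
      the arbitrary value \<open>par 0\<close>.\<close>
    have p: "0 < par k" "par k < k" "par (par k) < k" if "4 \<le> k" "k \<le> m" for k
      using par_pos[of k] par_less[of k] par_less[of "par k"] that m by auto
    show ?thesis
    proof (rule modular_block_differences[of _ u])
      show "finite (B m)" using finite_R by (simp add: B_def)
    next
      fix a assume "a \<in> T m"
      then consider "a \<in> S" | k where "4 \<le> k" "k < m" "a \<in> B k" by (auto simp: T_def)
      then show "a \<bullet> u = 0"
      proof cases
        case 1
        then show ?thesis using m u(2)[of 0] u(2)[of 1] u(2)[of 2] u(2)[of 3]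
          by (auto simp: S_def inner_add_left)
      next
        case 2
        then show ?thesis using m u p[of k] by (auto simp: B_def inner_add_left)
      qed
    next
      fix a assume "a \<in> B m"
      then show "a \<bullet> u \<noteq> 0"
        using m p[of m] u by (auto simp: B_def inner_add_left)
    next
      have m0: "0 < m" using m by simp
      have e: "b (par m) \<in> T m" if "b m + b (par m) \<in> R"
        using T_b edge_closed[OF that m0 m(2)] p[of m] m by simp
      \<comment> \<open>Up to sign, a difference of two roots of block \<open>m\<close> is a subpath
        of the path with \<open>m\<close> removed; closure puts all these subpaths into
        \<open>T m\<close>.\<close>
      have f: "b (par m) + b (par (par m)) \<in> T m \<and> b (par (par m)) \<in> T m \<and> b (par m) \<in> T m"
        if "b m + b (par m) + b (par (par m)) \<in> R"
      proof -
        have pm: "0 < par m" "par m < m" "par (par m) < m" using p[of m] m by auto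
        note c = path_closed[OF that pm(1) m0 m(2)]
        then show ?thesis
          using T_edge[of "par m" m] T_b[of "par m" m] T_b[of "par (par m)" m]
            edge_closed[of "par m"] pm m by auto
      qed
      fix a a' assume aa: "a \<in> B m" "a' \<in> B m" "a \<noteq> a'"
      show "a - a' \<in> T m \<or> a' - a \<in> T m"
        using aa e f unfolding B_def by (auto simp: add.assoc)
    qed (use u in auto)
  qed
  have "\<exists>\<pi>. inductively_factored_pair ?V (hyp ?V ` T m) \<pi>" if "4 \<le> m" "m \<le> n" for m
    using that
  proof (induction m rule: dec_induct)
    case base
    then show ?case using \<open>\<exists>\<pi>. inductively_factored_pair ?V (hyp ?V ` S) \<pi>\<close> by (simp add: T_def)
  next
    case (step m)
    then obtain \<pi> where "inductively_factored_pair ?V (hyp ?V ` T m) \<pi>" by auto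
    then have "inductively_factored_pair ?V (hyp ?V ` T m) (filter (\<lambda>B. B \<noteq> {}) \<pi>)"
      by (simp add: filter_nonempty_factored)
    then have "\<exists>\<pi>. inductively_factored_pair ?V (hyp ?V ` (T m \<union> B m)) \<pi>"
      using inductively_factored_hyp_Un \<open>\<And>m. 4 \<le> m \<Longrightarrow> m < n \<Longrightarrow> modular_block ?V (hyp ?V ` T m) (hyp ?V ` B m)\<close>
        step.hyps step.prems by (metis Suc_le_lessD)
    moreover have "T (Suc m) = T m \<union> B m"
      using step.hyps by (auto simp: T_def less_Suc_eq)
    ultimately show ?case by simp
  qed
  then have "inductively_factored ?V (hyp ?V ` T n)" using n4 by (auto simp: inductively_factored_def)
  moreover have "T n = R"
  proof
    show "R \<subseteq> T n"
    proof
      fix \<alpha> assume \<alpha>: "\<alpha> \<in> R"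
      then have "\<alpha> \<in> positive_roots \<Phi> \<Delta>" "ht \<Delta> \<alpha> < 4"
        using assms by (auto simp: R_def height_ideal_def not_le[symmetric])
      from low_roots[OF this] consider k where "k < n" "\<alpha> = b k"
        | k where "k < n" "0 < k" "\<alpha> = b k + b (par k)"
        | k where "k < n" "4 \<le> k" "\<alpha> = b k + b (par k) + b (par (par k))"
        | i j where "0 < i" "i < j" "j < 4" "\<alpha> = b 0 + b i + b j"
        by blast
      then show "\<alpha> \<in> T n"
      proof cases
        case 1
        then show ?thesis using T_b \<alpha> by blast
      next
        case 2
        then show ?thesis using T_edge \<alpha> by blast
      next
        case 3
        then show ?thesis using \<alpha> by (auto simp: T_def B_def)
      next
        case 4
        then have "i = 1 \<and> j = 2 \<or> i = 1 \<and> j = 3 \<or> i = 2 \<and> j = 3" by linarith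
        then show ?thesis using \<alpha> 4 by (auto simp: T_def S_def ac_simps)
      qed
    qed
  qed (auto simp: T_def S_def B_def)
  ultimately show ?thesis by (simp add: arrangement_hyp)
qed

end

end

section \<open>Numbering the diagrams of types D and E\<close>

lemma labelled_tree_of_dynkin:
  assumes "root_system \<Phi>" "simple_roots \<Phi> \<Delta>" "has_dynkin_diagram \<Delta> n E" "4 \<le> n"
    and \<sigma>: "inj_on \<sigma> {..<n}" "\<sigma> ` {..<n} \<subseteq> {1..n}"
    and E: "\<And>j k. j < k \<Longrightarrow> k < n \<Longrightarrow> {\<sigma> j, \<sigma> k} \<in> E \<longleftrightarrow> j = par k"
    and par: "\<And>k. 0 < k \<Longrightarrow> k < n \<Longrightarrow> par k < k" "\<And>k. 0 < k \<Longrightarrow> k < 4 \<Longrightarrow> par k = 0"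
      "\<And>k. 4 \<le> k \<Longrightarrow> k < n \<Longrightarrow> 0 < par k" "inj_on par {4..<n}"
  shows "\<exists>b. labelled_tree \<Phi> \<Delta> b par n"
proof -
  obtain a where a: "bij_betw a {1..n} \<Delta>"
    "\<And>i j. i \<in> {1..n} \<Longrightarrow> j \<in> {1..n} \<Longrightarrow> i \<noteq> j \<Longrightarrow>
      cartan_int (a i) (a j) = (if {i, j} \<in> E then - 1 else 0)"
    using assms(3) unfolding has_dynkin_diagram_def by blast
  have "\<sigma> ` {..<n} = {1..n}"
    using \<sigma> by (intro card_subset_eq) (auto simp: card_image)
  then have bs: "bij_betw \<sigma> {..<n} {1..n}" using \<sigma>(1) by (simp add: bij_betw_def)
  have "labelled_tree \<Phi> \<Delta> (a \<circ> \<sigma>) par n"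
  proof
    show "bij_betw (a \<circ> \<sigma>) {..<n} \<Delta>" using bs a(1) by (rule bij_betw_trans)
    fix j k assume jk: "j < k" "k < n"
    then have m: "\<sigma> j \<in> {1..n}" "\<sigma> k \<in> {1..n}" "\<sigma> j \<noteq> \<sigma> k"
    proof -
      have "j \<in> {..<n}" "k \<in> {..<n}" "j \<noteq> k" using jk by auto
      then show "\<sigma> j \<in> {1..n}" "\<sigma> k \<in> {1..n}" "\<sigma> j \<noteq> \<sigma> k"
        using \<sigma> inj_onD[OF \<sigma>(1)] by blast+
    qed
    then show "cartan_int ((a \<circ> \<sigma>) j) ((a \<circ> \<sigma>) k) = (if j = par k then - 1 else 0) \<and>
      cartan_int ((a \<circ> \<sigma>) k) ((a \<circ> \<sigma>) j) = (if j = par k then - 1 else 0)"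
      using a(2)[OF m] a(2)[OF m(2,1) m(3)[symmetric]] E[OF jk] by (simp add: insert_commute)
  qed (use assms in auto)
  then show ?thesis by blast
qed

text \<open>The branch vertex n - 2 has neighbours n - 1, n and n - 3. Only the arm through n - 3
  can have more than one vertex; it runs down to 1, which gives \<open>n - k\<close> from k = 3
  on.\<close>

lemma labelled_tree_D:
  assumes "root_system \<Phi>" "simple_roots \<Phi> \<Delta>" "type_D n \<Delta>" "4 \<le> n"
  shows "\<exists>b par. labelled_tree \<Phi> \<Delta> b par n"
proof -
  define \<sigma> where "\<sigma> k = (if k = 0 then n - 2 else if k = 1 then n - 1 else if k = 2 then n else n - k)" for k
  define par :: "nat \<Rightarrow> nat" where "par k = (if k < 4 then 0 else k - 1)" for k
  have E: "{p, q} \<in> insert {n - 2, n} {{i, i + 1} |i. 1 \<le> i \<and> i \<le> n - 2} \<longleftrightarrow>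
      (p = n - 2 \<and> q = n) \<or> (q = n - 2 \<and> p = n) \<or>
      (q = p + 1 \<and> 1 \<le> p \<and> p \<le> n - 2) \<or> (p = q + 1 \<and> 1 \<le> q \<and> q \<le> n - 2)" for p q
    by (auto simp: doubleton_eq_iff)
  have "\<exists>b. labelled_tree \<Phi> \<Delta> b par n"
  proof (rule labelled_tree_of_dynkin[OF assms(1,2) assms(3)[unfolded type_D_def] assms(4)])
    show "inj_on \<sigma> {..<n}" using assms(4) by (auto simp: inj_on_def \<sigma>_def split: if_splits)
    show "\<sigma> ` {..<n} \<subseteq> {1..n}" using assms(4) by (auto simp: \<sigma>_def)
    show "{\<sigma> j, \<sigma> k} \<in> insert {n - 2, n} {{i, i + 1} |i. 1 \<le> i \<and> i \<le> n - 2} \<longleftrightarrow> j = par k"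
      if jk: "j < k" "k < n" for j k
    proof -
      \<comment> \<open>Additive gaps between \<open>j\<close>, \<open>k\<close> and
        \<open>n\<close> let the truncated subtractions in \<open>\<sigma>\<close> be
        evaluated.\<close>
      obtain e where e: "k = Suc (j + e)" using less_imp_Suc_add[OF jk(1)] by blast
      obtain d where d: "n = Suc (k + d)" using less_imp_Suc_add[OF jk(2)] by blast
      have "j = 0 \<or> j = 1 \<or> j = 2 \<or> 3 \<le> j" "k = 1 \<or> k = 2 \<or> k = 3 \<or> 4 \<le> k"
        using that by linarith+
      then show ?thesis
        unfolding E using assms(4) e d by (elim disjE; force simp: \<sigma>_def par_def)
    qed
  qed (auto simp: par_def inj_on_def)
  then show ?thesis by blast
qed

text \<open>The branch vertex 4 has neighbours 3, 2 and 5. The arm through 3 ends in vertex 1, which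
  gets number 4; the arm through 5 goes on with 6, 7, ... under numbers 5, 6, ..., hence the
  irregular values of \<open>par\<close> at 4 and 5.\<close>

lemma labelled_tree_E:
  assumes "root_system \<Phi>" "simple_roots \<Phi> \<Delta>" "type_E n \<Delta>" "6 \<le> n"
  shows "\<exists>b par. labelled_tree \<Phi> \<Delta> b par n"
proof -
  define \<sigma> :: "nat \<Rightarrow> nat" where "\<sigma> k = (if k = 0 then 4 else if k = 1 then 3 else if k = 2 then 2
    else if k = 3 then 5 else if k = 4 then 1 else k + 1)" for k
  define par :: "nat \<Rightarrow> nat" where
    "par k = (if k < 4 then 0 else if k = 4 then 1 else if k = 5 then 3 else k - 1)" for k
  have E: "{p, q} \<in> {{1, 3}, {2, 4}} \<union> {{i, i + 1} |i. 3 \<le> i \<and> i < n} \<longleftrightarrow>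
      (p = 1 \<and> q = 3) \<or> (q = 1 \<and> p = 3) \<or> (p = 2 \<and> q = 4) \<or> (q = 2 \<and> p = 4) \<or>
      (q = p + 1 \<and> 3 \<le> p \<and> p < n) \<or> (p = q + 1 \<and> 3 \<le> q \<and> q < n)" for p q :: nat
    by (auto simp: doubleton_eq_iff)
  have "\<exists>b. labelled_tree \<Phi> \<Delta> b par n"
  proof (rule labelled_tree_of_dynkin[OF assms(1,2) assms(3)[unfolded type_E_def]])
    show "inj_on \<sigma> {..<n}" by (auto simp: inj_on_def \<sigma>_def split: if_splits)
    show "\<sigma> ` {..<n} \<subseteq> {1..n}" using assms(4) by (auto simp: \<sigma>_def)
    show "{\<sigma> j, \<sigma> k} \<in> {{1, 3}, {2, 4}} \<union> {{i, i + 1} |i. 3 \<le> i \<and> i < n} \<longleftrightarrow> j = par k"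
      if "j < k" "k < n" for j k
    proof -
      have "j = 0 \<or> j = 1 \<or> j = 2 \<or> j = 3 \<or> j = 4 \<or> 5 \<le> j"
        "k = 1 \<or> k = 2 \<or> k = 3 \<or> k = 4 \<or> k = 5 \<or> 6 \<le> k"
        using that by linarith+
      then show ?thesis
        unfolding E using that assms(4) by (elim disjE) (auto simp: \<sigma>_def par_def)
    qed
  qed (use assms(4) in \<open>auto simp: par_def inj_on_def split: if_splits\<close>)
  then show ?thesis by blast
qed

theorem theorem1p31:
  fixes \<Phi> \<Delta> I :: "'a::euclidean_space set"
  assumes "root_system \<Phi>"
    and "simple_roots \<Phi> \<Delta>"
    and "(\<exists>n\<ge>4. type_D n \<Delta>) \<or> type_E 6 \<Delta> \<or> type_E 7 \<Delta> \<or> type_E 8 \<Delta>"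
    and "root_ideal \<Phi> \<Delta> I"
  shows "(height_ideal \<Phi> \<Delta> 3 \<subseteq> I \<longrightarrow> supersolvable (span \<Phi>) (ideal_arrangement \<Phi> \<Delta> I))
       \<and> (height_ideal \<Phi> \<Delta> 4 \<subseteq> I \<longrightarrow> inductively_factored (span \<Phi>) (ideal_arrangement \<Phi> \<Delta> I))"
proof -
  have "\<exists>n b par. labelled_tree \<Phi> \<Delta> b par n"
    using assms(3)
  proof (elim disjE exE conjE)
    show ?thesis if "4 \<le> n" "type_D n \<Delta>" for n
      using labelled_tree_D[OF assms(1,2) that(2,1)] by blast
  qed (use labelled_tree_E[OF assms(1,2)] in \<open>force+\<close>)
  then obtain n b par where "labelled_tree \<Phi> \<Delta> b par n" by blast
  then interpret labelled_tree \<Phi> \<Delta> b par n .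
  show ?thesis
    using supersolvable_ideal[OF assms(4)] inductively_factored_ideal[OF assms(4)] by blast
qed

end
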